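(* A $\mathbb{Z}^2\rtimes\mathcal{C}_s$-gain graph is $\mathbb{Z}^2\rtimes\mathcal{C}_s$-tight if and only if it can be obtained from a $\mathbb{Z}^2\rtimes\mathcal{C}_s$-tight gain graph on $K_1^1$ using a (possibly empty) sequence of gained $0$-extensions, gained $1$-extensions and gained loop-$1$-extensions.
   Context: The group: $\Gamma=\mathbb{Z}^2\rtimes\mathcal{C}_s$ is the group of isometries of $\mathbb{R}^2$ of the form $x\mapsto \sigma(x)+t$ with $t\in\mathbb{Z}^2$ and $\sigma\in\mathcal{C}_s=\{\mathrm{id},s\}$, $s(x,y)=(x,-y)$. The element $\sigma$ is the $\mathcal{C}_s$-component; elements with trivial $\mathcal{C}_s$-component are translations. Gain graphs: A $\Gamma$-gain graph $(G,m)$ is a finite multigraph $G=(V,E)$ (loops and parallel edges allowed) with each edge oriented and labelled by $m(e)\in\Gamma$, such that parallel edges (oriented the same way) have different gains and every loop has non-identity gain. An edge from $v_i$ to $v_j$ is written $(v_i,v_j;m(e))$; reversing its orientation while inverting its gain is regarded as giving the same edge. The net gain of a walk $e_1^{\alpha_1}\cdots e_k^{\alpha_k}$ ($\alpha_i=1$ if $e_i$ is traversed forwards, $-1$ if backwards) is $\prod_{i=1}^k m(e_i)^{\alpha_i}$. The gain space at a vertex $v$ is the subgroup of $\Gamma$ generated by the net gains of closed walks starting and ending at $v$. A gain graph (or subgraph, with the restricted gains) is balanced if its gain space at every vertex is trivial, and purely periodic if its gain space at every vertex consists only of translations. Sparsity: A multigraph is $(k,l)$-sparse if every subgraph $(V',E')$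 with $|E'|\ge 1$ satisfies $|E'|\le k|V'|-l$; it is $(k,l)$-tight if moreover $|E|=k|V|-l$. $(G,m)$ is $\mathbb{Z}^2\rtimes\mathcal{C}_s$-tight if (1) $G$ is $(2,1)$-tight; (2) every purely periodic subgraph of $G$ is $(2,2)$-sparse; (3) every balanced subgraph of $G$ is $(2,3)$-sparse. $K_1^1$ is the multigraph with a single vertex and a single loop. Extensions (each must produce a valid gain graph; all other edges keep their gains): - A gained $0$-extension adds a new vertex $v_0$ with incident edges $e_1=(v_0,v_1;m(e_1))$ and $e_2=(v_0,v_2;m(e_2))$ for some not necessarily distinct $v_1,v_2\in V$. - A gained $1$-extension removes an edge $e=(v_1,v_2;m(e))$ (possibly a loop) and adds a new vertex $v_0$ with incident edges $e_i=(v_0,v_i;m(e_i))$, $i=1,2,3$, for some $v_3\in V$, where $m(e_1)^{-1}m(e_2)=m(e)$; the vertices $v_1,v_2,v_3\in V$ need not be distinct. - A gained loop-$1$-extension adds a new vertex $v_0$ with incident edges $l=(v_0,v_0;m(l))$ and $e=(v_0,v_1;m(e))$ for some $v_1\in V$, where $m(l)$ has non-trivial $\mathcal{C}_s$-component. *)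

theory Defs
  imports
    "HOL-Analysis.Analysis"
    "HOL-Algebra.Generated_Groups"
    "Graph_Theory.Digraph_Component"
begin

section \<open>The group of isometries\<close>

type_synonym plane = "real \<times> real"
type_synonym motion = "plane \<Rightarrow> plane"

definition refl_s :: motion where
  "refl_s = (\<lambda>(x, y). (x, - y))"

definition C_s :: "motion set" where
  "C_s = {id, refl_s}"

definition lattice_Z2 :: "plane set" where
  "lattice_Z2 = \<int> \<times> \<int>"

definition \<Gamma> :: "motion monoid" where
  "\<Gamma> = \<lparr> carrier = {\<lambda>x. \<sigma> x + t | \<sigma> t. \<sigma> \<in> C_s \<and> t \<in> lattice_Z2},
         monoid.mult = (\<circ>), one = id \<rparr>"

definition cs_component :: "motion \<Rightarrow> motion" where
  "cs_component g = (THE \<sigma>. \<sigma> \<in> C_s \<and> (\<exists>t \<in> lattice_Z2. g = (\<lambda>x. \<sigma> x + t)))"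

definition lattice_translations :: "motion set" where
  "lattice_translations = {g \<in> carrier \<Gamma>. cs_component g = id}"

lemma Gamma_memI: "\<sigma> \<in> C_s \<Longrightarrow> t \<in> lattice_Z2 \<Longrightarrow> (\<lambda>x. \<sigma> x + t) \<in> carrier \<Gamma>"
  unfolding \<Gamma>_def partial_object.simps mem_Collect_eq by (intro exI conjI) (rule refl)

lemma Gamma_memE:
  assumes "g \<in> carrier \<Gamma>"
  obtains \<sigma> t where "\<sigma> \<in> C_s" "t \<in> lattice_Z2" "g = (\<lambda>x. \<sigma> x + t)"
  using assms unfolding \<Gamma>_def partial_object.simps mem_Collect_eq by (elim exE conjE) (rule that)

lemma cs_component_eq:
  assumes "\<sigma> \<in> C_s" "t \<in> lattice_Z2"
  shows "cs_component (\<lambda>x. \<sigma> x + t) = \<sigma>"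
  unfolding cs_component_def
proof (rule the_equality)
  show "\<sigma> \<in> C_s \<and> (\<exists>t'\<in>lattice_Z2. (\<lambda>x. \<sigma> x + t) = (\<lambda>x. \<sigma> x + t'))"
    using assms by blast
next
  fix \<sigma>' assume "\<sigma>' \<in> C_s \<and> (\<exists>t'\<in>lattice_Z2. (\<lambda>x. \<sigma> x + t) = (\<lambda>x. \<sigma>' x + t'))"
  then obtain t' where *: "\<sigma>' \<in> C_s" "(\<lambda>x. \<sigma> x + t) = (\<lambda>x. \<sigma>' x + t')"
    by blast
  have eqs: "\<sigma> (0, 0) + t = \<sigma>' (0, 0) + t'" "\<sigma> (0, 1) + t = \<sigma>' (0, 1) + t'"
    using fun_cong[OF *(2), of "(0, 0)"] fun_cong[OF *(2), of "(0, 1)"] by simp_all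
  have "\<sigma> = id \<or> \<sigma> = refl_s" "\<sigma>' = id \<or> \<sigma>' = refl_s"
    using assms(1) *(1) by (simp_all add: C_s_def)
  then show "\<sigma>' = \<sigma>"
    using eqs by (elim disjE; cases t; cases t'; simp add: refl_s_def)
qed

lemma C_s_linear: "\<sigma> \<in> C_s \<Longrightarrow> \<sigma> (x + y) = \<sigma> x + \<sigma> y"
  and C_s_uminus: "\<sigma> \<in> C_s \<Longrightarrow> \<sigma> (- x) = - \<sigma> x"
  and C_s_involution: "\<sigma> \<in> C_s \<Longrightarrow> \<sigma> (\<sigma> x) = x"
  by (cases x; cases y; auto simp: C_s_def refl_s_def)+

lemma C_s_comp: "\<sigma> \<in> C_s \<Longrightarrow> \<tau> \<in> C_s \<Longrightarrow> \<sigma> \<circ> \<tau> \<in> C_s"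
  by (auto simp: C_s_def refl_s_def fun_eq_iff)

lemma C_s_lattice: "\<sigma> \<in> C_s \<Longrightarrow> t \<in> lattice_Z2 \<Longrightarrow> \<sigma> t \<in> lattice_Z2"
  by (auto simp: C_s_def refl_s_def lattice_Z2_def)

lemma lattice_add: "t \<in> lattice_Z2 \<Longrightarrow> u \<in> lattice_Z2 \<Longrightarrow> t + u \<in> lattice_Z2"
  by (auto simp: lattice_Z2_def)

lemma lattice_uminus: "t \<in> lattice_Z2 \<Longrightarrow> - t \<in> lattice_Z2"
  by (auto simp: lattice_Z2_def)

lemma Gamma_mult: "g \<otimes>\<^bsub>\<Gamma>\<^esub> h = g \<circ> h" and Gamma_one: "\<one>\<^bsub>\<Gamma>\<^esub> = id"
  by (simp_all add: \<Gamma>_def)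

lemma group_Gamma: "group \<Gamma>"
proof (rule groupI)
  fix g h assume "g \<in> carrier \<Gamma>" "h \<in> carrier \<Gamma>"
  then obtain \<sigma> t \<tau> u where *: "\<sigma> \<in> C_s" "t \<in> lattice_Z2" "g = (\<lambda>x. \<sigma> x + t)"
    "\<tau> \<in> C_s" "u \<in> lattice_Z2" "h = (\<lambda>x. \<tau> x + u)"
    by (elim Gamma_memE)
  have "g \<circ> h = (\<lambda>x. (\<sigma> \<circ> \<tau>) x + (\<sigma> u + t))"
    unfolding *(3,6) comp_def C_s_linear[OF *(1)] add.assoc ..
  also have "\<dots> \<in> carrier \<Gamma>"
    by (rule Gamma_memI[OF C_s_comp[OF *(1,4)] lattice_add[OF C_s_lattice[OF *(1,5)] *(2)]])
  finally show "g \<otimes>\<^bsub>\<Gamma>\<^esub> h \<in> carrier \<Gamma>" by (simp only: Gamma_mult)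
next
  fix g assume "g \<in> carrier \<Gamma>"
  then obtain \<sigma> t where *: "\<sigma> \<in> C_s" "t \<in> lattice_Z2" "g = (\<lambda>x. \<sigma> x + t)"
    by (elim Gamma_memE)
  have "(\<lambda>x. \<sigma> x + - \<sigma> t) \<in> carrier \<Gamma>"
    by (rule Gamma_memI[OF *(1) lattice_uminus[OF C_s_lattice[OF *(1,2)]]])
  moreover have "(\<lambda>x. \<sigma> x + - \<sigma> t) \<otimes>\<^bsub>\<Gamma>\<^esub> g = \<one>\<^bsub>\<Gamma>\<^esub>"
    unfolding Gamma_mult Gamma_one *(3) comp_def C_s_linear[OF *(1)] C_s_involution[OF *(1)]
    by (rule ext) simp
  ultimately show "\<exists>h\<in>carrier \<Gamma>. h \<otimes>\<^bsub>\<Gamma>\<^esub> g = \<one>\<^bsub>\<Gamma>\<^esub>" by blast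
next
  have "(\<lambda>x. id x + (0, 0)) \<in> carrier \<Gamma>"
    by (rule Gamma_memI[of id]) (simp_all add: C_s_def lattice_Z2_def)
  moreover have "(\<lambda>x. id x + (0, 0)) = (id :: motion)"
    by (simp add: fun_eq_iff zero_prod_def[symmetric])
  ultimately show "\<one>\<^bsub>\<Gamma>\<^esub> \<in> carrier \<Gamma>" by (simp only: Gamma_one)
qed (simp_all add: Gamma_mult Gamma_one comp_assoc)


section \<open>Gain graphs\<close>

text \<open>A multigraph with a reference orientation is a \<^typ>\<open>('v, 'e) pre_digraph\<close>; the gain
  map only matters on its arcs.  The predicate \<open>edge_as G m e u v g\<close> says that the edge \<open>e\<close> can
  be written as \<open>(u, v; g)\<close>, possibly after reversing it and inverting its gain; both
  ways of writing are used interchangeably below.\<close>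

definition edge_as ::
  "('v, 'e) pre_digraph \<Rightarrow> ('e \<Rightarrow> motion) \<Rightarrow> 'e \<Rightarrow> 'v \<Rightarrow> 'v \<Rightarrow> motion \<Rightarrow> bool" where
  "edge_as G m e u v g \<longleftrightarrow> e \<in> arcs G \<and>
     (tail G e = u \<and> head G e = v \<and> g = m e \<or>
      tail G e = v \<and> head G e = u \<and> g = inv\<^bsub>\<Gamma>\<^esub> (m e))"

definition gain_graph :: "('v, 'e) pre_digraph \<Rightarrow> ('e \<Rightarrow> motion) \<Rightarrow> bool" where
  "gain_graph G m \<longleftrightarrow>
     fin_digraph G \<and>
     (\<forall>e \<in> arcs G. m e \<in> carrier \<Gamma>) \<and>
     (\<forall>e f u v g h. edge_as G m e u v g \<and> edge_as G m f u v h \<and> e \<noteq> f \<longrightarrow> g \<noteq> h) \<and>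
     (\<forall>e \<in> arcs G. tail G e = head G e \<longrightarrow> m e \<noteq> \<one>\<^bsub>\<Gamma>\<^esub>)"

text \<open>Walks are lists of pairs \<open>(e, b)\<close>, where \<open>b\<close> tells whether \<open>e\<close> is traversed forwards.\<close>

fun is_walk :: "('v, 'e) pre_digraph \<Rightarrow> 'v \<Rightarrow> ('e \<times> bool) list \<Rightarrow> 'v \<Rightarrow> bool" where
  "is_walk G u [] v \<longleftrightarrow> u \<in> verts G \<and> u = v"
| "is_walk G u ((e, b) # p) v \<longleftrightarrow> e \<in> arcs G \<and>
     (if b then tail G e = u \<and> is_walk G (head G e) p v
      else head G e = u \<and> is_walk G (tail G e) p v)"

fun net_gain :: "('e \<Rightarrow> motion) \<Rightarrow> ('e \<times> bool) list \<Rightarrow> motion" where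
  "net_gain m [] = \<one>\<^bsub>\<Gamma>\<^esub>"
| "net_gain m ((e, b) # p) = (if b then m e else inv\<^bsub>\<Gamma>\<^esub> (m e)) \<otimes>\<^bsub>\<Gamma>\<^esub> net_gain m p"

definition gain_space :: "('v, 'e) pre_digraph \<Rightarrow> ('e \<Rightarrow> motion) \<Rightarrow> 'v \<Rightarrow> motion set" where
  "gain_space G m v = generate \<Gamma> {net_gain m p | p. is_walk G v p v}"

definition balanced :: "('v, 'e) pre_digraph \<Rightarrow> ('e \<Rightarrow> motion) \<Rightarrow> bool" where
  "balanced G m \<longleftrightarrow> (\<forall>v \<in> verts G. gain_space G m v = {\<one>\<^bsub>\<Gamma>\<^esub>})"

definition purely_periodic :: "('v, 'e) pre_digraph \<Rightarrow> ('e \<Rightarrow> motion) \<Rightarrow> bool" where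
  "purely_periodic G m \<longleftrightarrow> (\<forall>v \<in> verts G. gain_space G m v \<subseteq> lattice_translations)"


section \<open>Sparsity\<close>

definition sparse_graph :: "nat \<Rightarrow> nat \<Rightarrow> ('v, 'e) pre_digraph \<Rightarrow> bool" where
  "sparse_graph k l G \<longleftrightarrow> (\<forall>H. subgraph H G \<and> card (arcs H) \<ge> 1 \<longrightarrow>
     int (card (arcs H)) \<le> int k * int (card (verts H)) - int l)"

definition tight_graph :: "nat \<Rightarrow> nat \<Rightarrow> ('v, 'e) pre_digraph \<Rightarrow> bool" where
  "tight_graph k l G \<longleftrightarrow> sparse_graph k l G \<and>
     int (card (arcs G)) = int k * int (card (verts G)) - int l"

definition \<Gamma>_tight :: "('v, 'e) pre_digraph \<Rightarrow> ('e \<Rightarrow> motion) \<Rightarrow> bool" where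
  "\<Gamma>_tight G m \<longleftrightarrow>
     tight_graph 2 1 G \<and>
     (\<forall>H. subgraph H G \<and> purely_periodic H m \<longrightarrow> sparse_graph 2 2 H) \<and>
     (\<forall>H. subgraph H G \<and> balanced H m \<longrightarrow> sparse_graph 2 3 H)"

definition is_K11 :: "('v, 'e) pre_digraph \<Rightarrow> bool" where
  "is_K11 G \<longleftrightarrow> wf_digraph G \<and> card (verts G) = 1 \<and> card (arcs G) = 1"


section \<open>Extensions\<close>

text \<open>In each case \<open>(G, m)\<close> is an extension of \<open>(H, n)\<close>.  Edges are
  compared as undirected edges with gains, so an old edge may be stored in \<open>G\<close> with the opposite
  orientation and the inverse gain.\<close>

definition keeps_edge ::
  "('v, 'e) pre_digraph \<times> ('e \<Rightarrow> motion) \<Rightarrow> ('v, 'e) pre_digraph \<times> ('e \<Rightarrow> motion) \<Rightarrow> 'e \<Rightarrow> bool"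
where
  "keeps_edge = (\<lambda>(H, n) (G, m) e. edge_as G m e (tail H e) (head H e) (n e))"

definition gained_0_extension ::
  "('v, 'e) pre_digraph \<times> ('e \<Rightarrow> motion) \<Rightarrow> ('v, 'e) pre_digraph \<times> ('e \<Rightarrow> motion) \<Rightarrow> bool"
where
  "gained_0_extension = (\<lambda>(H, n) (G, m).
     gain_graph H n \<and> gain_graph G m \<and>
     (\<exists>v0 v1 v2 e1 e2 g1 g2.
        v0 \<notin> verts H \<and> v1 \<in> verts H \<and> v2 \<in> verts H \<and>
        distinct [e1, e2] \<and> {e1, e2} \<inter> arcs H = {} \<and>
        verts G = insert v0 (verts H) \<and>
        arcs G = arcs H \<union> {e1, e2} \<and>
        (\<forall>f \<in> arcs H. keeps_edge (H, n) (G, m) f) \<and>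
        edge_as G m e1 v0 v1 g1 \<and> edge_as G m e2 v0 v2 g2))"

text \<open>The names of the new edges only have to avoid the edges that are kept: the name of the
  removed edge may be reused.\<close>

definition gained_1_extension ::
  "('v, 'e) pre_digraph \<times> ('e \<Rightarrow> motion) \<Rightarrow> ('v, 'e) pre_digraph \<times> ('e \<Rightarrow> motion) \<Rightarrow> bool"
where
  "gained_1_extension = (\<lambda>(H, n) (G, m).
     gain_graph H n \<and> gain_graph G m \<and>
     (\<exists>v0 v1 v2 v3 e g e1 e2 e3 g1 g2 g3.
        v0 \<notin> verts H \<and> v3 \<in> verts H \<and> edge_as H n e v1 v2 g \<and>
        distinct [e1, e2, e3] \<and> {e1, e2, e3} \<inter> (arcs H - {e}) = {} \<and>
        verts G = insert v0 (verts H) \<and>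
        arcs G = (arcs H - {e}) \<union> {e1, e2, e3} \<and>
        (\<forall>f \<in> arcs H - {e}. keeps_edge (H, n) (G, m) f) \<and>
        edge_as G m e1 v0 v1 g1 \<and> edge_as G m e2 v0 v2 g2 \<and> edge_as G m e3 v0 v3 g3 \<and>
        inv\<^bsub>\<Gamma>\<^esub> g1 \<otimes>\<^bsub>\<Gamma>\<^esub> g2 = g))"

definition gained_loop_1_extension ::
  "('v, 'e) pre_digraph \<times> ('e \<Rightarrow> motion) \<Rightarrow> ('v, 'e) pre_digraph \<times> ('e \<Rightarrow> motion) \<Rightarrow> bool"
where
  "gained_loop_1_extension = (\<lambda>(H, n) (G, m).
     gain_graph H n \<and> gain_graph G m \<and>
     (\<exists>v0 v1 l e gl ge.
        v0 \<notin> verts H \<and> v1 \<in> verts H \<and>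
        distinct [l, e] \<and> {l, e} \<inter> arcs H = {} \<and>
        verts G = insert v0 (verts H) \<and>
        arcs G = arcs H \<union> {l, e} \<and>
        (\<forall>f \<in> arcs H. keeps_edge (H, n) (G, m) f) \<and>
        edge_as G m l v0 v0 gl \<and> edge_as G m e v0 v1 ge \<and>
        cs_component gl \<noteq> id))"

definition extension_step ::
  "('v, 'e) pre_digraph \<times> ('e \<Rightarrow> motion) \<Rightarrow> ('v, 'e) pre_digraph \<times> ('e \<Rightarrow> motion) \<Rightarrow> bool"
where
  "extension_step X Y \<longleftrightarrow>
     gained_0_extension X Y \<or> gained_1_extension X Y \<or> gained_loop_1_extension X Y"

end

theory Submission
  imports Defs
begin

text \<open>
  A tight graph on at least two vertices has a vertex \<open>v\<close> of degree two or three, and deleting \<open>v\<close>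
  undoes an extension unless three distinct edges \<open>a\<close>, \<open>b\<close>, \<open>c\<close> leave \<open>v\<close>, none of them a loop.  In
  that case two of the edges are replaced by one edge with the composed gain.  This fails for the
  pair \<open>a\<close>, \<open>b\<close> only because of a subgraph containing \<open>v\<close>, \<open>a\<close>, \<open>b\<close> but not \<open>c\<close> whose freedom
  \<open>2 |W| - |F|\<close> is the least possible for its kind (1 in general, 2 if purely periodic, 3 if
  balanced).  If all three pairs were blocked, modularity of the freedom would give
  the three subgraphs small intersections, so that the potentials witnessing the kind of each can
  be glued, and the union of the three would have less freedom than its kind allows.
\<close>

section \<open>Quotients of the group of isometries\<close>

text \<open>Sparsity, pure periodicity and balance are treated as one condition: if the gains on F
  come from a potential modulo the quotient of \<open>\<Gamma>\<close> indexed by l, then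
  \<open>card F + l \<le> 2 * card W\<close>. Potentials restrict to subgraphs and can be glued
  vertex by vertex, which closed walks cannot. The small degree comes from the total degree 2|E| =
  4|V| - 2. If a new edge between the other ends of a and b breaks the count on some subgraph,
  putting v, a and b in its place adds one vertex and one edge to the totals, so the freedom rises
  from at most l - 1 to at most l. The obstacle is that blocking subgraphs may be of different
  kinds, and that two of the same kind may meet in a disconnected graph, so that their union need
  not be of that kind. Both potentials can be made trivial at v; if they still differ, the
  intersection has a part away from v that adds at least 2 to its freedom, for which modularity
  leaves little room. Gluing is done at the least of the levels, which all the subgraphs
  share.\<close>

lemma Gamma_comp: "g \<in> carrier \<Gamma> \<Longrightarrow> h \<in> carrier \<Gamma> \<Longrightarrow> g \<circ> h \<in> carrier \<Gamma>"
  using group.is_monoid[OF group_Gamma, THEN monoid.m_closed, of g h] by (simp add: Gamma_mult)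

lemma Gamma_id: "id \<in> carrier \<Gamma>"
  using group.is_monoid[OF group_Gamma, THEN monoid.one_closed] by (simp add: Gamma_one)

lemma Gamma_inv: "g \<in> carrier \<Gamma> \<Longrightarrow> inv\<^bsub>\<Gamma>\<^esub> g \<in> carrier \<Gamma>"
  by (rule group.inv_closed[OF group_Gamma])

lemma Gamma_inv_left: "g \<in> carrier \<Gamma> \<Longrightarrow> inv\<^bsub>\<Gamma>\<^esub> g \<circ> g = id"
  using group.l_inv[OF group_Gamma, of g] by (simp add: Gamma_mult Gamma_one)

lemma Gamma_inv_right: "g \<in> carrier \<Gamma> \<Longrightarrow> g \<circ> inv\<^bsub>\<Gamma>\<^esub> g = id"
  using group.r_inv[OF group_Gamma, of g] by (simp add: Gamma_mult Gamma_one)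

lemma Gamma_cancel_right:
  assumes "c \<in> carrier \<Gamma>" "x \<circ> c = y \<circ> c" shows "x = y"
proof -
  have "x \<circ> c \<circ> inv\<^bsub>\<Gamma>\<^esub> c = y \<circ> c \<circ> inv\<^bsub>\<Gamma>\<^esub> c" using assms(2) by simp
  then show ?thesis by (simp add: comp_assoc Gamma_inv_right[OF assms(1)])
qed

lemma Gamma_cancel_left:
  assumes "c \<in> carrier \<Gamma>" "c \<circ> x = c \<circ> y" shows "x = y"
proof -
  have "inv\<^bsub>\<Gamma>\<^esub> c \<circ> (c \<circ> x) = inv\<^bsub>\<Gamma>\<^esub> c \<circ> (c \<circ> y)" using assms(2) by simp
  then show ?thesis by (simp add: comp_assoc[symmetric] Gamma_inv_left[OF assms(1)])
qed

lemma C_s_sub_Gamma: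
  assumes "\<sigma> \<in> C_s" shows "\<sigma> \<in> carrier \<Gamma>"
proof -
  have "(0 :: plane) \<in> lattice_Z2" by (simp add: lattice_Z2_def zero_prod_def)
  then show ?thesis using Gamma_memI[OF assms, of 0] by simp
qed

lemma cs_component_in: "g \<in> carrier \<Gamma> \<Longrightarrow> cs_component g \<in> C_s"
  by (elim Gamma_memE) (simp add: cs_component_eq)

lemma cs_component_comp:
  assumes "g \<in> carrier \<Gamma>" "h \<in> carrier \<Gamma>"
  shows "cs_component (g \<circ> h) = cs_component g \<circ> cs_component h"
proof -
  obtain \<sigma> t \<tau> u where *: "\<sigma> \<in> C_s" "t \<in> lattice_Z2" "g = (\<lambda>x. \<sigma> x + t)"
    "\<tau> \<in> C_s" "u \<in> lattice_Z2" "h = (\<lambda>x. \<tau> x + u)"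
    using assms by (elim Gamma_memE)
  have "g \<circ> h = (\<lambda>x. (\<sigma> \<circ> \<tau>) x + (\<sigma> u + t))"
    unfolding *(3,6) comp_def C_s_linear[OF *(1)] add.assoc ..
  then have "cs_component (g \<circ> h) = \<sigma> \<circ> \<tau>"
    using cs_component_eq[OF C_s_comp[OF *(1,4)] lattice_add[OF C_s_lattice[OF *(1,5)] *(2)]]
    by simp
  then show ?thesis using * by (simp add: cs_component_eq)
qed

lemma cs_component_id: "cs_component id = id"
proof -
  have "(0 :: plane) \<in> lattice_Z2" by (simp add: lattice_Z2_def zero_prod_def)
  then show ?thesis using cs_component_eq[of id 0] by (simp add: C_s_def id_def)
qed

text \<open>The endomorphisms \<open>level 1\<close>, \<open>level 2\<close>, \<open>level 3\<close> realise the quotients of \<open>\<Gamma>\<close> by \<open>\<Gamma>\<close>, by the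
  translations and by the trivial group.  They are numbered so that a subgraph which is balanced
  modulo level \<open>l\<close> has to be \<open>(2, l)\<close>-sparse.\<close>

definition level :: "nat \<Rightarrow> motion \<Rightarrow> motion" where
  "level l g = (if l = 3 then g else if l = 2 then cs_component g else id)"

lemma level_closed: "g \<in> carrier \<Gamma> \<Longrightarrow> level l g \<in> carrier \<Gamma>"
  by (simp add: level_def Gamma_id C_s_sub_Gamma cs_component_in)

lemma level_comp:
  "g \<in> carrier \<Gamma> \<Longrightarrow> h \<in> carrier \<Gamma> \<Longrightarrow> level l (g \<circ> h) = level l g \<circ> level l h"
  by (simp add: level_def cs_component_comp)

lemma level_id: "level l id = id"
  by (simp add: level_def cs_component_id)

lemma level_inv_left: "g \<in> carrier \<Gamma> \<Longrightarrow> level l (inv\<^bsub>\<Gamma>\<^esub> g) \<circ> level l g = id"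
  by (simp add: level_comp[symmetric] Gamma_inv Gamma_inv_left level_id)

lemma level_inv_right: "g \<in> carrier \<Gamma> \<Longrightarrow> level l g \<circ> level l (inv\<^bsub>\<Gamma>\<^esub> g) = id"
  by (simp add: level_comp[symmetric] Gamma_inv Gamma_inv_right level_id)

section \<open>Potentials\<close>

text \<open>The maps \<open>\<phi>\<close> below play the role of switchings: a subgraph is balanced or purely periodic iff
  its gains come from a potential at level 3 or 2.\<close>

definition potential ::
  "('v, 'e) pre_digraph \<Rightarrow> ('e \<Rightarrow> motion) \<Rightarrow> nat \<Rightarrow> ('v \<Rightarrow> motion) \<Rightarrow> 'e set \<Rightarrow> bool" where
  "potential G m l \<phi> F \<longleftrightarrow> range \<phi> \<subseteq> carrier \<Gamma> \<and>
     (\<forall>e \<in> F. \<phi> (head G e) = \<phi> (tail G e) \<circ> level l (m e))"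

definition level_balanced ::
  "('v, 'e) pre_digraph \<Rightarrow> ('e \<Rightarrow> motion) \<Rightarrow> nat \<Rightarrow> 'e set \<Rightarrow> bool" where
  "level_balanced G m l F \<longleftrightarrow> (\<exists>\<phi>. potential G m l \<phi> F)"

lemma potential_carrier: "potential G m l \<phi> F \<Longrightarrow> \<phi> v \<in> carrier \<Gamma>"
  by (auto simp: potential_def)

lemma potential_mono: "potential G m l \<phi> F \<Longrightarrow> F' \<subseteq> F \<Longrightarrow> potential G m l \<phi> F'"
  by (auto simp: potential_def)

lemma level_balanced_mono: "level_balanced G m l F \<Longrightarrow> F' \<subseteq> F \<Longrightarrow> level_balanced G m l F'"
  by (auto simp: level_balanced_def intro: potential_mono)

text \<open>Since \<open>level l\<close> is a homomorphism, reversing an edge and inverting its gain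
  only solves the same equation for the other end. All later arguments may therefore orient edges as
  they like.\<close>

lemma potential_edge_iff:
  assumes "edge_as G m e u v g" "m e \<in> carrier \<Gamma>"
  shows "\<phi> (head G e) = \<phi> (tail G e) \<circ> level l (m e) \<longleftrightarrow> \<phi> v = \<phi> u \<circ> level l g"
proof -
  have "\<phi> v = \<phi> u \<circ> level l (m e) \<longleftrightarrow> \<phi> u = \<phi> v \<circ> level l (inv\<^bsub>\<Gamma>\<^esub> (m e))" for u v
    using level_inv_left[OF assms(2), of l] level_inv_right[OF assms(2), of l]
    by (auto simp: comp_assoc)
  then show ?thesis using assms(1) by (auto simp: edge_as_def)
qed

lemma potential_edge:
  "potential G m l \<phi> F \<Longrightarrow> e \<in> F \<Longrightarrow> edge_as G m e u v g \<Longrightarrow> m e \<in> carrier \<Gamma> \<Longrightarrow>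
    \<phi> v = \<phi> u \<circ> level l g"
  by (subst potential_edge_iff[symmetric]) (auto simp: potential_def)

lemma edge_as_carrier: "edge_as G m e u v g \<Longrightarrow> m e \<in> carrier \<Gamma> \<Longrightarrow> g \<in> carrier \<Gamma>"
  by (auto simp: edge_as_def Gamma_inv)

text \<open>Gains act on the right, so composing all values with one constant on the left keeps
  every edge equation.\<close>

lemma potential_normalise:
  assumes "potential G m l \<phi> F"
  shows "\<exists>\<psi>. potential G m l \<psi> F \<and> \<psi> v = id"
proof (intro exI conjI)
  let ?c = "inv\<^bsub>\<Gamma>\<^esub> (\<phi> v)"
  show "potential G m l (\<lambda>w. ?c \<circ> \<phi> w) F"
    using assms by (auto simp: potential_def comp_assoc intro!: Gamma_comp Gamma_inv)
  show "?c \<circ> \<phi> v = id"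
    by (rule Gamma_inv_left[OF potential_carrier[OF assms]])
qed

lemma level_balanced_normalise:
  "level_balanced G m l F \<Longrightarrow> \<exists>\<psi>. potential G m l \<psi> F \<and> \<psi> v = id"
  by (auto simp: level_balanced_def intro: potential_normalise)

lemma level_balanced_1: "level_balanced G m (Suc 0) F"
  unfolding level_balanced_def potential_def
  by (rule exI[of _ "\<lambda>_. id"]) (auto simp: level_def Gamma_id)

text \<open>The only case with content goes from balanced to purely periodic: composing the
  potential with the homomorphism \<open>cs_component\<close> gives one at level 2.\<close>

lemma level_balanced_antimono:
  assumes "level_balanced G m l F" "\<forall>e\<in>F. m e \<in> carrier \<Gamma>" "k \<le> l" "1 \<le> k" "l \<le> 3"
  shows "level_balanced G m k F"
proof -
  consider "k = l" | "k = Suc 0" | "k = 2" "l = 3" using assms(3-5) by linarith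
  then show ?thesis
  proof cases
    case 3
    obtain \<phi> where \<phi>: "potential G m 3 \<phi> F" using assms(1) 3 by (auto simp: level_balanced_def)
    have c: "\<phi> v \<in> carrier \<Gamma>" for v using \<phi> by (rule potential_carrier)
    have "potential G m 2 (\<lambda>v. cs_component (\<phi> v)) F"
      using \<phi> c assms(2)
      by (auto simp: potential_def level_def C_s_sub_Gamma cs_component_in cs_component_comp)
    then show ?thesis using 3 by (auto simp: level_balanced_def)
  qed (use assms(1) level_balanced_1 in auto)
qed

text \<open>Subgraphs are pairs of sets sharing the ends of \<open>G\<close>, so unions and
  intersections of subgraphs are plain set operations.\<close>

definition subpair :: "('v, 'e) pre_digraph \<Rightarrow> 'v set \<Rightarrow> 'e set \<Rightarrow> bool" where
  "subpair G W F \<longleftrightarrow> W \<subseteq> verts G \<and> F \<subseteq> arcs G \<and> tail G ` F \<subseteq> W \<and> head G ` F \<subseteq> W"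

text \<open>The three sparsity conditions in one, written additively to stay within the natural
  numbers.\<close>

definition gain_sparse :: "('v, 'e) pre_digraph \<Rightarrow> ('e \<Rightarrow> motion) \<Rightarrow> bool" where
  "gain_sparse G m \<longleftrightarrow> (\<forall>W F l. subpair G W F \<and> F \<noteq> {} \<and> 1 \<le> l \<and> l \<le> 3 \<and>
     level_balanced G m l F \<longrightarrow> card F + l \<le> 2 * card W)"

lemma gain_sparseD:
  "gain_sparse G m \<Longrightarrow> subpair G W F \<Longrightarrow> F \<noteq> {} \<Longrightarrow> 1 \<le> l \<Longrightarrow> l \<le> 3 \<Longrightarrow>
    level_balanced G m l F \<Longrightarrow> card F + l \<le> 2 * card W"
  by (simp add: gain_sparse_def)

text \<open>Each edge has both ends in \<open>W\<close> or both in \<open>W'\<close>; agreement on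
  the overlap makes the choice between \<phi> and \<psi> immaterial for the second kind.\<close>

lemma potential_glue:
  assumes "potential G m l \<phi> F" "potential G m l \<psi> F'" "subpair G W F" "subpair G W' F'"
    and "\<And>v. v \<in> W \<Longrightarrow> v \<in> W' \<Longrightarrow> \<phi> v = \<psi> v"
  shows "potential G m l (\<lambda>v. if v \<in> W then \<phi> v else \<psi> v) (F \<union> F')"
  using assms by (auto simp: potential_def subpair_def image_subset_iff)

section \<open>Closed walks and potentials\<close>

lemma net_gain_Nil: "net_gain m [] = id"
  by (simp only: net_gain.simps Gamma_one)

lemma net_gain_Cons:
  "net_gain m ((e, b) # p) = (if b then m e else inv\<^bsub>\<Gamma>\<^esub> (m e)) \<circ> net_gain m p"
  by (simp only: net_gain.simps Gamma_mult)

declare net_gain.simps [simp del]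

lemma net_gain_carrier:
  "is_walk G u p v \<Longrightarrow> \<forall>e\<in>arcs G. m e \<in> carrier \<Gamma> \<Longrightarrow> net_gain m p \<in> carrier \<Gamma>"
  by (induction p arbitrary: u)
    (auto simp: net_gain_Nil net_gain_Cons Gamma_id split: if_splits intro!: Gamma_comp Gamma_inv)

lemma potential_walk:
  assumes "potential G m l \<phi> (arcs G)" "\<forall>e\<in>arcs G. m e \<in> carrier \<Gamma>"
  shows "is_walk G u p v \<Longrightarrow> \<phi> v = \<phi> u \<circ> level l (net_gain m p)"
proof (induction p arbitrary: u)
  case Nil
  then have "u = v" by simp
  then show ?case by (simp only: net_gain_Nil level_id comp_id)
next
  case (Cons a p)
  obtain e b where a: "a = (e, b)" by (cases a)
  let ?w = "if b then head G e else tail G e" and ?g = "if b then m e else inv\<^bsub>\<Gamma>\<^esub> (m e)"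
  have e: "e \<in> arcs G" "edge_as G m e u ?w ?g" and p: "is_walk G ?w p v"
    using Cons.prems by (auto simp: a edge_as_def split: if_splits)
  have c: "?g \<in> carrier \<Gamma>" "net_gain m p \<in> carrier \<Gamma>"
    using e(1) assms(2) net_gain_carrier[OF p assms(2)] by (auto intro: Gamma_inv)
  have "\<phi> v = \<phi> ?w \<circ> level l (net_gain m p)" by (rule Cons.IH[OF p])
  also have "\<phi> ?w = \<phi> u \<circ> level l ?g"
    using potential_edge[OF assms(1) e] e(1) assms(2) by blast
  finally show ?case
    by (simp only: a net_gain_Cons level_comp[OF c] comp_assoc)
qed

lemma is_walk_append:
  "is_walk G u p v \<Longrightarrow> is_walk G v q w \<Longrightarrow> is_walk G u (p @ q) w"
  by (induction p arbitrary: u) (auto split: if_splits)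

lemma net_gain_append:
  assumes "\<forall>e\<in>arcs G. m e \<in> carrier \<Gamma>"
  shows "is_walk G u p v \<Longrightarrow> net_gain m (p @ q) = net_gain m p \<circ> net_gain m q"
  by (induction p arbitrary: u) (auto simp: net_gain_Cons net_gain_Nil comp_assoc split: if_splits)

definition reverse_walk :: "('e \<times> bool) list \<Rightarrow> ('e \<times> bool) list" where
  "reverse_walk p = rev (map (\<lambda>(e, b). (e, \<not> b)) p)"

lemma is_walk_verts: "wf_digraph G \<Longrightarrow> is_walk G u p v \<Longrightarrow> u \<in> verts G \<and> v \<in> verts G"
  by (induction p arbitrary: u)
    (auto split: if_splits intro: wf_digraph.tail_in_verts wf_digraph.head_in_verts)

lemma is_walk_reverse:
  assumes "wf_digraph G"
  shows "is_walk G u p v \<Longrightarrow> is_walk G v (reverse_walk p) u"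
proof (induction p arbitrary: u)
  case Nil then show ?case by (auto simp: reverse_walk_def)
next
  case (Cons a p)
  obtain e b where a: "a = (e, b)" by (cases a)
  let ?w = "if b then head G e else tail G e"
  have p: "is_walk G ?w p v" using Cons.prems by (auto simp: a split: if_splits)
  have "is_walk G ?w [(e, \<not> b)] u"
    using Cons.prems is_walk_verts[OF assms Cons.prems] by (auto simp: a split: if_splits)
  from is_walk_append[OF Cons.IH[OF p] this] show ?case
    by (simp only: a reverse_walk_def list.map rev.simps prod.case)
qed

text \<open>From right to left the gains telescope along a walk. From left to right, the potential
  at a vertex is the gain of a chosen path from a root of its component, and triviality on closed
  walks makes this independent of the path.\<close>

lemma closed_walks_level_trivial_iff:
  assumes wf: "wf_digraph G" and m: "\<forall>e\<in>arcs G. m e \<in> carrier \<Gamma>"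
  shows "(\<forall>v p. is_walk G v p v \<longrightarrow> level l (net_gain m p) = id) \<longleftrightarrow>
    level_balanced G m l (arcs G)"
proof
  assume "level_balanced G m l (arcs G)"
  then obtain \<phi> where \<phi>: "potential G m l \<phi> (arcs G)" by (auto simp: level_balanced_def)
  show "\<forall>v p. is_walk G v p v \<longrightarrow> level l (net_gain m p) = id"
  proof (intro allI impI)
    fix v p assume "is_walk G v p v"
    from potential_walk[OF \<phi> m this] have "\<phi> v \<circ> level l (net_gain m p) = \<phi> v \<circ> id" by simp
    then show "level l (net_gain m p) = id"
      by (rule Gamma_cancel_left[OF potential_carrier[OF \<phi>]])
  qed
next
  assume triv: "\<forall>v p. is_walk G v p v \<longrightarrow> level l (net_gain m p) = id"
  define conn where "conn u v \<longleftrightarrow> (\<exists>p. is_walk G u p v)" for u v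
  define root where "root v = (SOME r. conn r v)" for v
  define path where "path v = (SOME p. is_walk G (root v) p v)" for v
  have conn_sym: "conn v u" if "conn u v" for u v
    using that is_walk_reverse[OF wf] by (auto simp: conn_def)
  have conn_trans: "conn u w" if "conn u v" "conn v w" for u v w
    using that is_walk_append by (fastforce simp: conn_def)
  have refl: "conn v v" if "v \<in> verts G" for v
    using that by (auto simp: conn_def intro!: exI[of _ "[]"])
  have path: "is_walk G (root v) (path v) v" if "v \<in> verts G" for v
  proof -
    have "conn (root v) v" unfolding root_def using refl[OF that] by (rule someI)
    then show ?thesis unfolding conn_def path_def by (rule someI_ex)
  qed
  \<comment> \<open>Connected vertices satisfy the same predicate under \<open>SOME\<close>, hence
    get the same root.\<close>
  have root_eq: "root u = root v" if "conn u v" for u v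
  proof -
    have "conn r u \<longleftrightarrow> conn r v" for r
      using conn_trans[OF _ that] conn_trans[OF _ conn_sym[OF that]] by blast
    then show ?thesis by (simp add: root_def)
  qed
  \<comment> \<open>The default \<open>id\<close> outside the graph is there because a potential
    must take values in \<open>carrier \<Gamma>\<close> everywhere.\<close>
  define \<phi> where "\<phi> v = (if v \<in> verts G then level l (net_gain m (path v)) else id)" for v
  have "potential G m l \<phi> (arcs G)"
    unfolding potential_def
  proof (intro conjI ballI)
    show "range \<phi> \<subseteq> carrier \<Gamma>"
      using net_gain_carrier[OF path m] by (auto simp: \<phi>_def Gamma_id intro!: level_closed)
  next
    fix e assume e: "e \<in> arcs G"
    let ?u = "tail G e" and ?v = "head G e"
    have uv: "?u \<in> verts G" "?v \<in> verts G"
      using e wf by (auto intro: wf_digraph.tail_in_verts wf_digraph.head_in_verts)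
    have step: "is_walk G ?u [(e, True)] ?v" using e uv by simp
    have r: "root ?u = root ?v" by (rule root_eq) (unfold conn_def, rule exI, rule step)
    have walk_u: "is_walk G (root ?v) (path ?u @ [(e, True)]) ?v"
      using is_walk_append[OF path[OF uv(1)] step] r by simp
    have bwalk: "is_walk G ?v (reverse_walk (path ?v)) (root ?v)"
      by (rule is_walk_reverse[OF wf path[OF uv(2)]])
    let ?a = "level l (net_gain m (path ?u @ [(e, True)]))" and ?b = "level l (net_gain m (path ?v))"
      and ?c = "level l (net_gain m (reverse_walk (path ?v)))"
    \<comment> \<open>Both walks from the root to \<open>?v\<close> are closed up by the same
      reversed path, so cancelling its gain \<open>?c\<close> compares them without computing the
      gain of a reversed walk.\<close>
    have "?a \<circ> ?c = id"
      using triv is_walk_append[OF walk_u bwalk]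
      unfolding net_gain_append[OF m walk_u, symmetric]
        level_comp[OF net_gain_carrier[OF walk_u m] net_gain_carrier[OF bwalk m], symmetric]
      by blast
    moreover have "?b \<circ> ?c = id"
      using triv is_walk_append[OF path[OF uv(2)] bwalk]
      unfolding net_gain_append[OF m path[OF uv(2)], symmetric]
        level_comp[OF net_gain_carrier[OF path[OF uv(2)] m] net_gain_carrier[OF bwalk m], symmetric]
      by blast
    ultimately have ab: "?a = ?b"
      using Gamma_cancel_right[OF level_closed[OF net_gain_carrier[OF bwalk m]], of ?a l ?b] by simp
    have "?a = level l (net_gain m (path ?u)) \<circ> level l (m e)"
      using net_gain_append[OF m path[OF uv(1)]] level_comp[OF net_gain_carrier[OF path[OF uv(1)] m]] e m
      by (simp add: net_gain_Cons net_gain_Nil)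
    then show "\<phi> ?v = \<phi> ?u \<circ> level l (m e)" using uv ab by (simp add: \<phi>_def)
  qed
  then show "level_balanced G m l (arcs G)" by (auto simp: level_balanced_def)
qed

section \<open>Gain spaces and tightness in terms of potentials\<close>

lemma subgroup_lattice_translations: "subgroup lattice_translations \<Gamma>"
proof (rule group.subgroupI[OF group_Gamma])
  show "lattice_translations \<subseteq> carrier \<Gamma>" by (auto simp: lattice_translations_def)
  show "lattice_translations \<noteq> {}"
    using Gamma_id cs_component_id by (auto simp: lattice_translations_def)
  fix g assume g: "g \<in> lattice_translations"
  then show "inv\<^bsub>\<Gamma>\<^esub> g \<in> lattice_translations"
    using level_inv_left[of g 2] by (auto simp: lattice_translations_def level_def Gamma_inv)
  fix h assume "h \<in> lattice_translations"
  with g show "g \<otimes>\<^bsub>\<Gamma>\<^esub> h \<in> lattice_translations"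
    by (auto simp: lattice_translations_def Gamma_mult Gamma_comp cs_component_comp)
qed

text \<open>A subgroup contains a generated group once it contains the generators, so only single
  closed walks need to be examined.\<close>

lemma gain_space_subset_iff:
  assumes "subgroup N \<Gamma>"
  shows "gain_space G m v \<subseteq> N \<longleftrightarrow> (\<forall>p. is_walk G v p v \<longrightarrow> net_gain m p \<in> N)"
  unfolding gain_space_def
proof
  assume "generate \<Gamma> {net_gain m p |p. is_walk G v p v} \<subseteq> N"
  then show "\<forall>p. is_walk G v p v \<longrightarrow> net_gain m p \<in> N" by (blast intro: generate.incl)
next
  assume "\<forall>p. is_walk G v p v \<longrightarrow> net_gain m p \<in> N"
  then show "generate \<Gamma> {net_gain m p |p. is_walk G v p v} \<subseteq> N"
    by (intro group.generate_subgroup_incl[OF group_Gamma _ assms]) blast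
qed

lemma balanced_iff_level:
  assumes wf: "wf_digraph G" and m: "\<forall>e\<in>arcs G. m e \<in> carrier \<Gamma>"
  shows "balanced G m \<longleftrightarrow> level_balanced G m 3 (arcs G)"
proof -
  have "gain_space G m v = {\<one>\<^bsub>\<Gamma>\<^esub>} \<longleftrightarrow> gain_space G m v \<subseteq> {\<one>\<^bsub>\<Gamma>\<^esub>}" for v
    unfolding gain_space_def by (blast intro: generate.one)
  also have "gain_space G m v \<subseteq> {\<one>\<^bsub>\<Gamma>\<^esub>} \<longleftrightarrow>
      (\<forall>p. is_walk G v p v \<longrightarrow> level 3 (net_gain m p) = id)" for v
    unfolding gain_space_subset_iff[OF group.triv_subgroup[OF group_Gamma]]
    by (simp only: singleton_iff Gamma_one level_def if_True simp_thms)
  finally show ?thesis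
    unfolding balanced_def closed_walks_level_trivial_iff[OF assms, symmetric]
    using is_walk_verts[OF wf] by blast
qed

lemma purely_periodic_iff_level:
  assumes wf: "wf_digraph G" and m: "\<forall>e\<in>arcs G. m e \<in> carrier \<Gamma>"
  shows "purely_periodic G m \<longleftrightarrow> level_balanced G m 2 (arcs G)"
proof -
  have "level 2 g = cs_component g" for g by (simp add: level_def)
  then have "net_gain m p \<in> lattice_translations \<longleftrightarrow> level 2 (net_gain m p) = id"
    if "is_walk G v p v" for v p
    using net_gain_carrier[OF that m] by (simp only: lattice_translations_def mem_Collect_eq simp_thms)
  then show ?thesis
    unfolding purely_periodic_def closed_walks_level_trivial_iff[OF assms, symmetric]
      gain_space_subset_iff[OF subgroup_lattice_translations]
    using is_walk_verts[OF wf] by blast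
qed

lemma level_balanced_cong:
  "tail G = tail H \<Longrightarrow> head G = head H \<Longrightarrow> level_balanced G m l F = level_balanced H m l F"
  by (simp add: level_balanced_def potential_def)

text \<open>Level balance passes to subgraphs, so the count for each subgraph of a given kind
  already yields sparsity of every graph of that kind; conversely such a graph is counted as a
  subgraph of itself. Level 1 holds for every edge set and accounts for the condition on
  \<open>G\<close> as a whole.\<close>

lemma tight_iff_gain_sparse:
  assumes fin: "fin_digraph G" and m: "\<forall>e\<in>arcs G. m e \<in> carrier \<Gamma>"
  shows "\<Gamma>_tight G m \<longleftrightarrow> card (arcs G) + 1 = 2 * card (verts G) \<and> gain_sparse G m"
proof -
  interpret fin_digraph G by (rule fin)
  have wf: "wf_digraph G" by unfold_locales
  have level: "balanced H m \<longleftrightarrow> level_balanced G m 3 (arcs H)"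
    "purely_periodic H m \<longleftrightarrow> level_balanced G m 2 (arcs H)" if "subgraph H G" for H
  proof -
    have H: "wf_digraph H" "\<forall>e\<in>arcs H. m e \<in> carrier \<Gamma>" "tail H = tail G" "head H = head G"
      using that m by (auto simp: subgraph_def compatible_def)
    show "balanced H m \<longleftrightarrow> level_balanced G m 3 (arcs H)"
      "purely_periodic H m \<longleftrightarrow> level_balanced G m 2 (arcs H)"
      using balanced_iff_level[OF H(1,2)] purely_periodic_iff_level[OF H(1,2)]
        level_balanced_cong[OF H(3,4)] by auto
  qed
  have sub: "subgraph \<lparr>verts = W, arcs = F, tail = tail G, head = head G\<rparr> G \<longleftrightarrow> subpair G W F"
    for W F
    using wf by (auto simp: subgraph_def compatible_def subpair_def wf_digraph_def)
  have sub': "subpair G (verts H) (arcs H)" if "subgraph H G" for H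
    using that by (auto simp: subgraph_def compatible_def subpair_def wf_digraph_def)
  have fin_arcs: "finite F" if "subpair G W F" for W F
    using that finite_subset[OF _ finite_arcs] by (auto simp: subpair_def)
  show ?thesis
  proof
    assume tight: "\<Gamma>_tight G m"
    show "card (arcs G) + 1 = 2 * card (verts G) \<and> gain_sparse G m"
      unfolding gain_sparse_def
    proof (intro conjI allI impI; (elim conjE)?)
      show "card (arcs G) + 1 = 2 * card (verts G)"
        using tight by (simp add: \<Gamma>_tight_def tight_graph_def)
      fix W F l
      assume *: "subpair G W F" "F \<noteq> {}" "1 \<le> l" "l \<le> (3::nat)" "level_balanced G m l F"
      let ?H = "\<lparr>verts = W, arcs = F, tail = tail G, head = head G\<rparr>"
      have H: "subgraph ?H G" "subgraph ?H ?H"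
        using *(1) sub by (auto simp: subgraph_def compatible_def)
      have "card F \<ge> 1" using fin_arcs[OF *(1)] *(2) by (simp add: Suc_le_eq card_gt_0_iff)
      then have count: "int (card F) \<le> 2 * int (card W) - int k"
        if "sparse_graph 2 k X" "subgraph ?H X" for k X
        using that by (auto simp: sparse_graph_def dest!: spec[of _ ?H])
      have "sparse_graph 2 1 G"
        using tight by (simp add: \<Gamma>_tight_def tight_graph_def)
      moreover have "l = 2 \<Longrightarrow> sparse_graph 2 2 ?H" "l = 3 \<Longrightarrow> sparse_graph 2 3 ?H"
        using tight H(1) *(5) level[OF H(1)] by (simp_all add: \<Gamma>_tight_def)
      moreover have "l = 1 \<or> l = 2 \<or> l = 3" using *(3,4) by linarith
      ultimately have "int (card F) \<le> 2 * int (card W) - int l"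
        using count H by blast
      then show "card F + l \<le> 2 * card W" by linarith
    qed
  next
    assume *: "card (arcs G) + 1 = 2 * card (verts G) \<and> gain_sparse G m"
    have count: "int (card (arcs H)) \<le> int 2 * int (card (verts H)) - int l"
      if "subgraph H G" "1 \<le> card (arcs H)" "1 \<le> l" "l \<le> 3" "level_balanced G m l (arcs H)" for H l
    proof -
      have "arcs H \<noteq> {}" using that(2) by auto
      then have "card (arcs H) + l \<le> 2 * card (verts H)"
        using gain_sparseD[of G m "verts H" "arcs H" l] * that sub' by auto
      then show ?thesis by linarith
    qed
    have sp: "sparse_graph 2 l H" if "subgraph H G" "1 \<le> l" "l \<le> 3" "level_balanced G m l (arcs H)" for H l
      unfolding sparse_graph_def
    proof (intro allI impI; elim conjE)
      fix H' assume H': "subgraph H' H" "1 \<le> card (arcs H')"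
      show "int (card (arcs H')) \<le> int 2 * int (card (verts H')) - int l"
      proof (rule count)
        show "subgraph H' G" using H' that(1) by (blast intro: subgraph_trans)
        show "level_balanced G m l (arcs H')"
          by (rule level_balanced_mono[OF that(4)]) (use H'(1) in \<open>auto simp: subgraph_def\<close>)
      qed (use H' that in auto)
    qed
    have "subgraph G G" using wf by (simp add: subgraph_refl)
    then have "sparse_graph 2 1 G" using sp[of G 1] level_balanced_1[of G m] by simp
    moreover have "int (card (arcs G)) = int 2 * int (card (verts G)) - int 1" using * by linarith
    ultimately show "\<Gamma>_tight G m"
      using sp level by (auto simp: \<Gamma>_tight_def tight_graph_def)
  qed
qed

lemma edge_as_arc: "edge_as G m e u v g \<Longrightarrow> e \<in> arcs G"
  by (simp add: edge_as_def)

lemma edge_as_subpair_iff: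
  "edge_as G m e u v g \<Longrightarrow> tail G e \<in> W \<and> head G e \<in> W \<longleftrightarrow> u \<in> W \<and> v \<in> W"
  by (auto simp: edge_as_def)

lemma edge_as_in_subpair: "edge_as G m e u v g \<Longrightarrow> subpair G W F \<Longrightarrow> e \<in> F \<Longrightarrow> u \<in> W \<and> v \<in> W"
  by (subst edge_as_subpair_iff[symmetric]) (auto simp: subpair_def)

lemma edge_as_self: "e \<in> arcs G \<Longrightarrow> edge_as G m e (tail G e) (head G e) (m e)"
  by (simp add: edge_as_def)

lemma gain_graphD:
  assumes "gain_graph G m"
  shows "fin_digraph G" "\<forall>e\<in>arcs G. m e \<in> carrier \<Gamma>"
    and "edge_as G m e u v g \<Longrightarrow> edge_as G m f u v g \<Longrightarrow> e = f"
  using assms unfolding gain_graph_def by blast+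

lemma subpair_finite:
  "fin_digraph G \<Longrightarrow> subpair G W F \<Longrightarrow> finite W \<and> finite F"
  by (auto simp: subpair_def fin_digraph_def fin_digraph_axioms_def intro: finite_subset)

text \<open>This makes validity of the reduced graphs automatic. Two parallel edges of equal gain
  are balanced on two vertices, but 2 + 3 > 4; two loops at a vertex break level 1, as 2 + 1 > 2; a
  loop with identity gain is balanced, but 1 + 3 > 2.\<close>

lemma gain_sparse_imp_gain_graph:
  assumes fin: "fin_digraph G" and m: "\<forall>e\<in>arcs G. m e \<in> carrier \<Gamma>" and sp: "gain_sparse G m"
  shows "gain_graph G m"
proof -
  interpret fin_digraph G by (rule fin)
  have parallel: "e = f" if e: "edge_as G m e u v g" and f: "edge_as G m f u v g" for e f u v g
  proof (rule ccontr)
    assume "e \<noteq> f"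
    then have card: "card {e, f} = 2" by simp
    have arcs: "e \<in> arcs G" "f \<in> arcs G" using e f by (auto intro: edge_as_arc)
    have uv: "u \<in> verts G \<and> v \<in> verts G"
      using edge_as_subpair_iff[OF e, of "verts G"] arcs by auto
    have sub: "subpair G {u, v} {e, f}"
      unfolding subpair_def
      using arcs uv edge_as_subpair_iff[OF e, of "{u, v}"] edge_as_subpair_iff[OF f, of "{u, v}"]
      by simp
    show False
    proof (cases "u = v")
      case True
      then show False
        using gain_sparseD[OF sp sub _ _ _ level_balanced_1] card by simp
    next
      case False
      have g: "g \<in> carrier \<Gamma>" using edge_as_carrier[OF e] arcs m by blast
      let ?\<phi> = "\<lambda>w. if w = v then g else id"
      have "?\<phi> v = ?\<phi> u \<circ> level 3 g" using False by (simp add: level_def)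
      then have "potential G m 3 ?\<phi> {e, f}"
        using potential_edge_iff[OF e, of ?\<phi> 3] potential_edge_iff[OF f, of ?\<phi> 3] arcs m g
        unfolding potential_def by (auto simp: Gamma_id)
      then have "level_balanced G m 3 {e, f}" unfolding level_balanced_def by blast
      from gain_sparseD[OF sp sub _ _ _ this] card False show False by simp
    qed
  qed
  have loop: "m e \<noteq> \<one>\<^bsub>\<Gamma>\<^esub>" if "e \<in> arcs G" "tail G e = head G e" for e
  proof
    assume "m e = \<one>\<^bsub>\<Gamma>\<^esub>"
    then have "m e = id" by (simp only: Gamma_one)
    then have "potential G m 3 (\<lambda>_. id) {e}"
      using Gamma_id unfolding potential_def by (auto simp: level_def)
    then have "level_balanced G m 3 {e}" unfolding level_balanced_def by blast
    moreover have "subpair G {tail G e} {e}" using that by (simp add: subpair_def)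
    ultimately show False using gain_sparseD[OF sp, of "{tail G e}" "{e}" 3] by simp
  qed
  show ?thesis
    unfolding gain_graph_def
  proof (intro conjI allI impI fin m)
    show "g \<noteq> h" if "edge_as G m e u v g \<and> edge_as G m f u v h \<and> e \<noteq> f" for e f u v g h
      using parallel that by blast
    show "\<forall>e\<in>arcs G. tail G e = head G e \<longrightarrow> m e \<noteq> \<one>\<^bsub>\<Gamma>\<^esub>"
      using loop by (intro ballI impI)
  qed
qed

section \<open>Extensions preserve tightness\<close>

text \<open>If old edges \<open>F0\<close> are present, the new vertex pays for the two new edges.
  Otherwise the bound cannot be inherited: one edge spans two vertices, which suffices for all
  levels, and two edges suffice up to level 2; at level 3 the new edges must have distinct far ends,
  since otherwise balance would make their gains equal. The edges \<open>a\<close> and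
  \<open>b\<close> may coincide.\<close>

lemma gain_sparse_count_two_new_edges:
  assumes G: "gain_graph G m" and sub: "subpair G W F" and "F \<noteq> {}" "v0 \<in> W"
    and l: "l \<le> 3" and bal: "level_balanced G m l F"
    and a: "edge_as G m a v0 va ga" "va \<noteq> v0" and b: "edge_as G m b v0 vb gb" "vb \<noteq> v0"
    and F: "F \<subseteq> F0 \<union> {a, b}" "F0 \<subseteq> F"
    and F0: "F0 \<noteq> {} \<Longrightarrow> card F0 + l \<le> 2 * card (W - {v0})"
  shows "card F + l \<le> 2 * card W"
proof -
  have fin: "finite W" "finite F" using subpair_finite[OF gain_graphD(1)[OF G] sub] by auto
  have W: "card W = card (W - {v0}) + 1" using card.remove[OF fin(1) \<open>v0 \<in> W\<close>] by simp
  show ?thesis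
  proof (cases "F0 = {}")
    case False
    have "card F \<le> card (F0 \<union> {a, b})" using F fin(2) by (intro card_mono) (auto intro: finite_subset)
    also have "\<dots> \<le> card F0 + card {a, b}" by (rule card_Un_le)
    also have "card {a, b} \<le> 2" by (simp add: card_insert_if)
    finally show ?thesis using F0[OF False] W by linarith
  next
    case True
    have in_W: "a \<in> F \<Longrightarrow> va \<in> W" "b \<in> F \<Longrightarrow> vb \<in> W"
      using edge_as_in_subpair[OF a(1) sub] edge_as_in_subpair[OF b(1) sub] by auto
    have sub_card: "card X \<le> card W" if "X \<subseteq> W" for X using that fin(1) by (rule card_mono[rotated])
    have W2: "2 \<le> card W"
      using F True \<open>F \<noteq> {}\<close> in_W \<open>v0 \<in> W\<close> a(2) b(2) sub_card[of "{v0, va}"] sub_card[of "{v0, vb}"]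
      by auto
    show ?thesis
    proof (cases "F = {a, b} \<and> a \<noteq> b")
      case False
      then have "F \<subseteq> {a} \<or> F \<subseteq> {b}" using F True by blast
      then have "card F \<le> 1"
        using card_mono[of "{a}" F] card_mono[of "{b}" F] by auto
      then show ?thesis using W2 l by linarith
    next
      case ab: True
      show ?thesis
      proof (cases "l = 3")
        case False
        then show ?thesis using ab W2 l by simp
      next
        case True
        have "va \<noteq> vb"
        proof
          assume "va = vb"
          obtain \<phi> where \<phi>: "potential G m 3 \<phi> F" using bal True by (auto simp: level_balanced_def)
          have arcs: "m a \<in> carrier \<Gamma>" "m b \<in> carrier \<Gamma>"
            using gain_graphD(2)[OF G] a(1) b(1) by (auto dest: edge_as_arc)
          have "\<phi> v0 \<circ> ga = \<phi> v0 \<circ> gb"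
            using potential_edge[OF \<phi> _ a(1) arcs(1)] potential_edge[OF \<phi> _ b(1) arcs(2)] ab \<open>va = vb\<close>
            by (simp add: level_def)
          then have "ga = gb" by (rule Gamma_cancel_left[OF potential_carrier[OF \<phi>]])
          then show False using gain_graphD(3)[OF G, of a v0 va ga b] a b ab \<open>va = vb\<close> by simp
        qed
        then have "3 \<le> card W" using sub_card[of "{v0, va, vb}"] in_W ab \<open>v0 \<in> W\<close> a(2) b(2) by simp
        then show ?thesis using True ab by simp
      qed
    qed
  qed
qed

text \<open>A kept edge may be stored in the opposite direction in the larger graph; the same \<phi>
  still works because the edge equation does not depend on the orientation.\<close>

lemma restrict_to_kept_edges:
  assumes G: "gain_graph G m" and keeps: "\<forall>f\<in>F0. keeps_edge (H, n) (G, m) f"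
    and sub: "subpair G W F" and F0: "F0 \<subseteq> F" "F0 \<subseteq> arcs H" and wf: "wf_digraph H"
  shows "subpair H (W \<inter> verts H) F0"
    and "potential G m l \<phi> F \<Longrightarrow> potential H n l \<phi> F0"
proof -
  have keep: "edge_as G m f (tail H f) (head H f) (n f)" if "f \<in> F0" for f
    using keeps that by (simp add: keeps_edge_def)
  show "subpair H (W \<inter> verts H) F0"
    using edge_as_in_subpair[OF keep sub] F0 wf_digraph.tail_in_verts[OF wf] wf_digraph.head_in_verts[OF wf]
    unfolding subpair_def by blast
  show "potential H n l \<phi> F0" if "potential G m l \<phi> F"
  proof -
    have "\<phi> (head H f) = \<phi> (tail H f) \<circ> level l (n f)" if f: "f \<in> F0" for f
      using potential_edge[OF \<open>potential G m l \<phi> F\<close> _ keep[OF f]] F0(1) f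
        gain_graphD(2)[OF G] edge_as_arc[OF keep[OF f]] by blast
    then show ?thesis using that by (simp add: potential_def)
  qed
qed

lemma gain_graph_wf: "gain_graph G m \<Longrightarrow> wf_digraph G"
  using gain_graphD(1) fin_digraph_def by blast

lemma extension_step_gain_graph:
  "extension_step (H, n) (G, m) \<Longrightarrow> gain_graph H n \<and> gain_graph G m"
  unfolding extension_step_def gained_0_extension_def gained_1_extension_def
    gained_loop_1_extension_def prod.case
  by (elim disjE conjE) (intro conjI, assumption, assumption)+

lemma gained_0_extension_gain_sparse:
  assumes ext: "gained_0_extension (H, n) (G, m)" and sp: "gain_sparse H n"
  shows "gain_sparse G m" "card (arcs G) = card (arcs H) + 2" "card (verts G) = card (verts H) + 1"
proof -
  have H: "gain_graph H n" and G: "gain_graph G m"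
    using extension_step_gain_graph ext unfolding extension_step_def by blast+
  obtain v0 v1 v2 e1 e2 g1 g2 where
    v: "v0 \<notin> verts H" "v1 \<in> verts H" "v2 \<in> verts H" and
    new: "distinct [e1, e2]" "{e1, e2} \<inter> arcs H = {}" and
    VE: "verts G = insert v0 (verts H)" "arcs G = arcs H \<union> {e1, e2}" and
    keep: "\<forall>f\<in>arcs H. keeps_edge (H, n) (G, m) f" and
    e: "edge_as G m e1 v0 v1 g1" "edge_as G m e2 v0 v2 g2"
    using ext unfolding gained_0_extension_def prod.case by (elim exE conjE) (rule that)
  interpret H: fin_digraph H by (rule gain_graphD(1)[OF H])
  show "card (arcs G) = card (arcs H) + 2"
    using new unfolding VE by (subst card_Un_disjoint) auto
  show "card (verts G) = card (verts H) + 1" using v(1) unfolding VE by simp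
  show "gain_sparse G m"
    unfolding gain_sparse_def
  proof (intro allI impI; elim conjE)
    fix W F l
    assume sub: "subpair G W F" and F: "F \<noteq> {}" and l: "1 \<le> l" "l \<le> (3::nat)"
      and bal: "level_balanced G m l F"
    let ?F0 = "F \<inter> arcs H" and ?W0 = "W \<inter> verts H"
    have sub0: "subpair H ?W0 ?F0" and bal0: "level_balanced H n l ?F0"
      using restrict_to_kept_edges[OF G _ sub _ _ gain_graph_wf[OF H], of ?F0 n] keep bal
      by (auto simp: level_balanced_def)
    have count: "card ?F0 + l \<le> 2 * card ?W0" if "?F0 \<noteq> {}"
      using gain_sparseD[OF sp sub0 that l bal0] .
    have sub': "W \<subseteq> insert v0 (verts H)" "F \<subseteq> arcs H \<union> {e1, e2}"
      using sub unfolding subpair_def VE by auto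
    show "card F + l \<le> 2 * card W"
    proof (cases "v0 \<in> W")
      case True
      have "?W0 = W - {v0}" using sub' v(1) by blast
      then show ?thesis
        using sub' v count True
        by (intro gain_sparse_count_two_new_edges[OF G sub F True l(2) bal e(1) _ e(2), of ?F0]) auto
    next
      case False
      then have "e1 \<notin> F" "e2 \<notin> F"
        using edge_as_in_subpair[OF e(1) sub] edge_as_in_subpair[OF e(2) sub] by auto
      then have "?F0 = F" "?W0 = W" using sub' False by auto
      then show ?thesis using count F by simp
    qed
  qed
qed

lemma gained_1_extension_gain_sparse:
  assumes ext: "gained_1_extension (H, n) (G, m)" and sp: "gain_sparse H n"
  shows "gain_sparse G m" "card (arcs G) = card (arcs H) + 2" "card (verts G) = card (verts H) + 1"
proof -
  have H: "gain_graph H n" and G: "gain_graph G m"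
    using extension_step_gain_graph ext unfolding extension_step_def by blast+
  obtain v0 v1 v2 v3 e g e1 e2 e3 g1 g2 g3 where
    v: "v0 \<notin> verts H" "v3 \<in> verts H" and old: "edge_as H n e v1 v2 g" and
    new: "distinct [e1, e2, e3]" "{e1, e2, e3} \<inter> (arcs H - {e}) = {}" and
    VE: "verts G = insert v0 (verts H)" "arcs G = (arcs H - {e}) \<union> {e1, e2, e3}" and
    keep: "\<forall>f\<in>arcs H - {e}. keeps_edge (H, n) (G, m) f" and
    e: "edge_as G m e1 v0 v1 g1" "edge_as G m e2 v0 v2 g2" "edge_as G m e3 v0 v3 g3" and
    g: "inv\<^bsub>\<Gamma>\<^esub> g1 \<otimes>\<^bsub>\<Gamma>\<^esub> g2 = g"
    using ext unfolding gained_1_extension_def prod.case by (elim exE conjE) (rule that)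
  interpret H: fin_digraph H by (rule gain_graphD(1)[OF H])
  have e_arc: "e \<in> arcs H" by (rule edge_as_arc[OF old])
  have v12: "v1 \<in> verts H" "v2 \<in> verts H"
    using edge_as_subpair_iff[OF old, of "verts H"] e_arc by auto
  have gs: "g1 \<in> carrier \<Gamma>" "g2 \<in> carrier \<Gamma>"
    using edge_as_carrier[OF e(1)] edge_as_carrier[OF e(2)] gain_graphD(2)[OF G]
      edge_as_arc[OF e(1)] edge_as_arc[OF e(2)] by auto
  have "card (arcs G) = card (arcs H - {e}) + card {e1, e2, e3}"
    using new unfolding VE by (intro card_Un_disjoint) auto
  then show "card (arcs G) = card (arcs H) + 2"
    using new card.remove[OF H.finite_arcs e_arc] by simp
  show "card (verts G) = card (verts H) + 1" using v(1) unfolding VE by simp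
  show "gain_sparse G m"
    unfolding gain_sparse_def
  proof (intro allI impI; elim conjE)
    fix W F l
    assume sub: "subpair G W F" and F: "F \<noteq> {}" and l: "1 \<le> l" "l \<le> (3::nat)"
      and bal: "level_balanced G m l F"
    \<comment> \<open>The edge \<open>e\<close> is excluded explicitly, since its name may be reused
      for a new edge and could then occur in \<open>F\<close>.\<close>
    let ?F0 = "F \<inter> (arcs H - {e})" and ?W0 = "W \<inter> verts H"
    have fin: "finite W" "finite F" using subpair_finite[OF gain_graphD(1)[OF G] sub] by auto
    obtain \<phi> where \<phi>: "potential G m l \<phi> F" using bal by (auto simp: level_balanced_def)
    have F0: "?F0 \<subseteq> F" "?F0 \<subseteq> arcs H" by auto
    have keep0: "\<forall>f\<in>?F0. keeps_edge (H, n) (G, m) f" using keep by blast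
    have sub0: "subpair H ?W0 ?F0" and pot0: "potential H n l \<phi> ?F0"
      using restrict_to_kept_edges[OF G keep0 sub F0 gain_graph_wf[OF H]] \<phi> by auto
    have count: "card ?F0 + l \<le> 2 * card ?W0" if "?F0 \<noteq> {}"
      using gain_sparseD[OF sp sub0 that l] pot0 by (auto simp: level_balanced_def)
    have sub': "W \<subseteq> insert v0 (verts H)" "F \<subseteq> (arcs H - {e}) \<union> {e1, e2, e3}"
      using sub unfolding subpair_def VE by auto
    have W0: "?W0 = W - {v0}" using sub' v(1) by blast
    show "card F + l \<le> 2 * card W"
    proof (cases "v0 \<in> W")
      case False
      then have "e1 \<notin> F" "e2 \<notin> F" "e3 \<notin> F"
        using edge_as_in_subpair[OF e(1) sub] edge_as_in_subpair[OF e(2) sub]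
          edge_as_in_subpair[OF e(3) sub] by auto
      then have "?F0 = F" using sub' by auto
      then show ?thesis using count F W0 False by simp
    next
      case True
      have W: "card W = card ?W0 + 1" using card.remove[OF fin(1) True] W0 by simp
      note two = gain_sparse_count_two_new_edges[OF G sub F True l(2) bal, where ?F0.0 = ?F0]
      consider "e1 \<notin> F" | "e2 \<notin> F" | "e3 \<notin> F" | "{e1, e2, e3} \<subseteq> F" by blast
      then show ?thesis
      proof cases
        case 1
        then show ?thesis using sub' v v12 count W0 by (intro two[OF e(2) _ e(3)]) auto
      next
        case 2
        then show ?thesis using sub' v v12 count W0 by (intro two[OF e(1) _ e(3)]) auto
      next
        case 3
        then show ?thesis using sub' v v12 count W0 by (intro two[OF e(1) _ e(2)]) auto
      next
        case 4
        \<comment> \<open>With all three new edges present the vertex pays for only two. The third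
          is paid for by putting the removed edge back: the composed gain of \<open>e1\<close>
          reversed and \<open>e2\<close> is g, so the same potential fits \<open>e\<close>.\<close>
        let ?F1 = "insert e ?F0"
        have W12: "v1 \<in> ?W0 \<and> v2 \<in> ?W0"
          using edge_as_in_subpair[OF e(1) sub] edge_as_in_subpair[OF e(2) sub] 4 v12 by auto
        have sub1: "subpair H ?W0 ?F1"
          using sub0 e_arc edge_as_subpair_iff[OF old, of ?W0] W12 by (auto simp: subpair_def)
        have ms: "m e1 \<in> carrier \<Gamma>" "m e2 \<in> carrier \<Gamma>" "n e \<in> carrier \<Gamma>"
          using gain_graphD(2)[OF G] gain_graphD(2)[OF H] e_arc edge_as_arc[OF e(1)] edge_as_arc[OF e(2)]
          by auto
        have "\<phi> v1 = \<phi> v0 \<circ> level l g1" "\<phi> v2 = \<phi> v0 \<circ> level l g2"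
          using potential_edge[OF \<phi> _ e(1) ms(1)] potential_edge[OF \<phi> _ e(2) ms(2)] 4 by auto
        moreover have "level l g = level l (inv\<^bsub>\<Gamma>\<^esub> g1) \<circ> level l g2"
          using level_comp[OF Gamma_inv[OF gs(1)] gs(2)] g by (simp only: Gamma_mult)
        ultimately have "\<phi> v2 = \<phi> v1 \<circ> level l g"
          using level_inv_right[OF gs(1), of l] by (metis comp_assoc comp_id)
        then have "potential H n l \<phi> ?F1"
          using pot0 potential_edge_iff[OF old ms(3), of \<phi> l] by (simp add: potential_def)
        then have "level_balanced H n l ?F1" by (auto simp: level_balanced_def)
        from gain_sparseD[OF sp sub1 _ l this]
        have "card ?F1 + l \<le> 2 * card ?W0" by simp
        moreover have "card ?F1 = card ?F0 + 1" using fin(2) by simp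
        moreover have "F = ?F0 \<union> {e1, e2, e3}" using 4 sub' by blast
        then have "card F \<le> card ?F0 + card {e1, e2, e3}" by (metis card_Un_le)
        moreover have "card {e1, e2, e3} = 3" using new(1) by simp
        ultimately show ?thesis using W by linarith
      qed
    qed
  qed
qed

lemma gained_loop_1_extension_gain_sparse:
  assumes ext: "gained_loop_1_extension (H, n) (G, m)" and sp: "gain_sparse H n"
  shows "gain_sparse G m" "card (arcs G) = card (arcs H) + 2" "card (verts G) = card (verts H) + 1"
proof -
  have H: "gain_graph H n" and G: "gain_graph G m"
    using extension_step_gain_graph ext unfolding extension_step_def by blast+
  obtain v0 v1 a b ga gb where
    v: "v0 \<notin> verts H" "v1 \<in> verts H" and
    new: "distinct [a, b]" "{a, b} \<inter> arcs H = {}" and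
    VE: "verts G = insert v0 (verts H)" "arcs G = arcs H \<union> {a, b}" and
    keep: "\<forall>f\<in>arcs H. keeps_edge (H, n) (G, m) f" and
    e: "edge_as G m a v0 v0 ga" "edge_as G m b v0 v1 gb" and ga: "cs_component ga \<noteq> id"
    using ext unfolding gained_loop_1_extension_def prod.case by (elim exE conjE) (rule that)
  interpret H: fin_digraph H by (rule gain_graphD(1)[OF H])
  show "card (arcs G) = card (arcs H) + 2"
    using new unfolding VE by (subst card_Un_disjoint) auto
  show "card (verts G) = card (verts H) + 1" using v(1) unfolding VE by simp
  have ms: "m a \<in> carrier \<Gamma>" "m b \<in> carrier \<Gamma>"
    using gain_graphD(2)[OF G] edge_as_arc[OF e(1)] edge_as_arc[OF e(2)] by auto
  show "gain_sparse G m"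
    unfolding gain_sparse_def
  proof (intro allI impI; elim conjE)
    fix W F l
    assume sub: "subpair G W F" and F: "F \<noteq> {}" and l: "1 \<le> l" "l \<le> (3::nat)"
      and bal: "level_balanced G m l F"
    let ?F0 = "F \<inter> arcs H" and ?W0 = "W \<inter> verts H"
    have fin: "finite W" "finite F" using subpair_finite[OF gain_graphD(1)[OF G] sub] by auto
    have sub0: "subpair H ?W0 ?F0" and bal0: "level_balanced H n l ?F0"
      using restrict_to_kept_edges[OF G _ sub _ _ gain_graph_wf[OF H], of ?F0 n] keep bal
      by (auto simp: level_balanced_def)
    have count: "card ?F0 + l \<le> 2 * card ?W0" if "?F0 \<noteq> {}"
      using gain_sparseD[OF sp sub0 that l bal0] .
    have sub': "W \<subseteq> insert v0 (verts H)" "F \<subseteq> arcs H \<union> {a, b}"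
      using sub unfolding subpair_def VE by auto
    have W0: "?W0 = W - {v0}" using sub' v(1) by blast
    show "card F + l \<le> 2 * card W"
    proof (cases "v0 \<in> W")
      case False
      then have "a \<notin> F" "b \<notin> F"
        using edge_as_in_subpair[OF e(1) sub] edge_as_in_subpair[OF e(2) sub] by auto
      then have "?F0 = F" "?W0 = W" using sub' False by auto
      then show ?thesis using count F by simp
    next
      case True
      have W: "card W = card ?W0 + 1" using card.remove[OF fin(1) True] W0 by simp
      show ?thesis
      proof (cases "a \<in> F")
        case False
        \<comment> \<open>Without the loop, \<open>b\<close> is the only possible new edge and takes
          both roles in the two-edge count.\<close>
        then show ?thesis
          using sub' v count W0
          by (intro gain_sparse_count_two_new_edges[OF G sub F True l(2) bal e(2) _ e(2), of ?F0]) auto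
      next
        case a: True
        \<comment> \<open>A potential at level 2 would force the loop to have trivial component, so
          only the weakest count is required.\<close>
        have "l = 1"
        proof (rule ccontr)
          assume "l \<noteq> 1"
          then have "level_balanced G m 2 F"
            using level_balanced_antimono[OF bal, of 2] l gain_graphD(2)[OF G] sub
            by (auto simp: subpair_def)
          then obtain \<phi> where \<phi>: "potential G m 2 \<phi> F" by (auto simp: level_balanced_def)
          from potential_edge[OF this a e(1) ms(1)]
          have "\<phi> v0 \<circ> level 2 ga = \<phi> v0 \<circ> id" by simp
          then have "level 2 ga = id" by (rule Gamma_cancel_left[OF potential_carrier[OF \<phi>]])
          then show False using ga by (simp add: level_def)
        qed
        have FF: "F = ?F0 \<union> (F \<inter> {a, b})" using sub' by blast
        have F_le: "card F \<le> card ?F0 + card (F \<inter> {a, b})" by (subst FF) (rule card_Un_le)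
        have ab: "card (F \<inter> {a, b}) \<le> 2"
          using card_mono[of "{a, b}" "F \<inter> {a, b}"] by (simp add: card_insert_if split: if_splits)
        show ?thesis
        proof (cases "?F0 = {}")
          case False
          then show ?thesis using count F_le ab W by simp
        next
          case F0: True
          show ?thesis
          proof (cases "b \<in> F")
            case True
            then have "{v0, v1} \<subseteq> W" using edge_as_in_subpair[OF e(2) sub] by blast
            then have "card {v0, v1} \<le> card W" using fin(1) by (intro card_mono)
            moreover have "v0 \<noteq> v1" using v by blast
            ultimately show ?thesis using F0 F_le ab \<open>l = 1\<close> by simp
          next
            case False
            then have "F = {a}" using F0 a sub' by blast
            then show ?thesis using \<open>l = 1\<close> W by simp
          qed
        qed
      qed
    qed
  qed
qed

lemma extension_step_gain_sparse:
  assumes "extension_step (H, n) (G, m)" "gain_sparse H n"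
  shows "gain_sparse G m" "card (arcs G) = card (arcs H) + 2" "card (verts G) = card (verts H) + 1"
proof -
  consider "gained_0_extension (H, n) (G, m)" | "gained_1_extension (H, n) (G, m)"
    | "gained_loop_1_extension (H, n) (G, m)"
    using assms(1) unfolding extension_step_def by (elim disjE)
  then have "gain_sparse G m \<and> card (arcs G) = card (arcs H) + 2 \<and>
      card (verts G) = card (verts H) + 1"
  proof cases
    case 1 from gained_0_extension_gain_sparse[OF this assms(2)] show ?thesis by simp
  next
    case 2 from gained_1_extension_gain_sparse[OF this assms(2)] show ?thesis by simp
  next
    case 3 from gained_loop_1_extension_gain_sparse[OF this assms(2)] show ?thesis by simp
  qed
  then show "gain_sparse G m" "card (arcs G) = card (arcs H) + 2"
    "card (verts G) = card (verts H) + 1" by auto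
qed

lemma extension_step_tight:
  assumes "extension_step (H, n) (G, m)" "\<Gamma>_tight H n"
  shows "\<Gamma>_tight G m"
proof -
  have H: "gain_graph H n" and G: "gain_graph G m"
    using extension_step_gain_graph[OF assms(1)] by auto
  have "card (arcs H) + 1 = 2 * card (verts H)" "gain_sparse H n"
    using assms(2) tight_iff_gain_sparse[OF gain_graphD(1,2)[OF H]] by auto
  with extension_step_gain_sparse[OF assms(1) this(2)] show ?thesis
    using tight_iff_gain_sparse[OF gain_graphD(1,2)[OF G]] by simp
qed

section \<open>Vertices of degree three\<close>

text \<open>Integer-valued, so that subtraction is unrestricted and modularity becomes a linear
  identity.\<close>

definition freedom :: "'v set \<Rightarrow> 'e set \<Rightarrow> int" where
  "freedom W F = 2 * int (card W) - int (card F)"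

locale degree_three_vertex =
  fixes G :: "('v, 'e) pre_digraph" and m :: "'e \<Rightarrow> motion"
    and v0 :: 'v and I :: "'e set" and nb :: "'e \<Rightarrow> 'v" and gn :: "'e \<Rightarrow> motion"
  assumes fin: "fin_digraph G" and gains: "\<forall>e\<in>arcs G. m e \<in> carrier \<Gamma>" and sparse: "gain_sparse G m"
    and I_def: "I = {e \<in> arcs G. tail G e = v0 \<or> head G e = v0}"
    and edge: "e \<in> I \<Longrightarrow> edge_as G m e v0 (nb e) (gn e)"
    and nb: "e \<in> I \<Longrightarrow> nb e \<noteq> v0"
begin

lemma nb': "e \<in> I \<Longrightarrow> v0 \<noteq> nb e"
  using nb[of e] by simp

lemma wf_subpair: "subpair G (verts G) (arcs G)"
  using fin wf_digraph.tail_in_verts wf_digraph.head_in_verts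
  by (fastforce simp: subpair_def fin_digraph_def)

lemma finite_subpair: "subpair G W F \<Longrightarrow> finite W" "subpair G W F \<Longrightarrow> finite F"
  by (rule subpair_finite[OF fin, THEN conjunct1] subpair_finite[OF fin, THEN conjunct2], assumption)+

lemma gain_in: "e \<in> I \<Longrightarrow> m e \<in> carrier \<Gamma>"
  using gains by (simp add: I_def)

lemma subpair_Un: "subpair G W F \<Longrightarrow> subpair G W' F' \<Longrightarrow> subpair G (W \<union> W') (F \<union> F')"
  unfolding subpair_def by (simp add: image_Un le_supI1 le_supI2)

lemma subpair_Int: "subpair G W F \<Longrightarrow> subpair G W' F' \<Longrightarrow> subpair G (W \<inter> W') (F \<inter> F')"
  unfolding subpair_def image_subset_iff by simp blast

lemma balanced_antimono:
  "level_balanced G m l F \<Longrightarrow> subpair G W F \<Longrightarrow> k \<le> l \<Longrightarrow> 1 \<le> k \<Longrightarrow> l \<le> 3 \<Longrightarrow> level_balanced G m k F"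
  using gains unfolding subpair_def by (intro level_balanced_antimono[of G m l F k]) blast+

lemma freedom_modular:
  assumes "subpair G W F" "subpair G W' F'"
  shows "freedom (W \<union> W') (F \<union> F') + freedom (W \<inter> W') (F \<inter> F') = freedom W F + freedom W' F'"
  using card_Un_Int[OF finite_subpair(1)[OF assms(1)] finite_subpair(1)[OF assms(2)]]
    card_Un_Int[OF finite_subpair(2)[OF assms(1)] finite_subpair(2)[OF assms(2)]]
  by (simp add: freedom_def)

lemma freedom_ge_level:
  assumes "subpair G W F" "F \<noteq> {}" "level_balanced G m l F" "1 \<le> l" "l \<le> 3"
  shows "int l \<le> freedom W F"
  using gain_sparseD[OF sparse assms(1,2,4,5,3)] by (simp add: freedom_def)

lemma freedom_ge_1: "subpair G W F \<Longrightarrow> F \<noteq> {} \<Longrightarrow> 1 \<le> freedom W F"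
  using freedom_ge_level[OF _ _ level_balanced_1] by simp

text \<open>Sparsity says nothing about an empty edge set, but then each vertex alone contributes 2.
  This is why the bound is 2 also at level 3.\<close>

lemma freedom_ge_2:
  assumes "subpair G W F" "W \<noteq> {}" "level_balanced G m l F" "2 \<le> l" "l \<le> 3"
  shows "2 \<le> freedom W F"
proof (cases "F = {}")
  case True
  have "0 < card W" using finite_subpair(1)[OF assms(1)] assms(2) by (simp add: card_gt_0_iff)
  then show ?thesis using True by (simp add: freedom_def)
next
  case False
  then show ?thesis using freedom_ge_level[OF assms(1) _ assms(3)] assms(4,5) by simp
qed

lemma in_subpair: "subpair G W F \<Longrightarrow> e \<in> I \<Longrightarrow> e \<in> F \<Longrightarrow> v0 \<in> W \<and> nb e \<in> W"
  by (rule edge_as_in_subpair[OF edge])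

lemma normalised_potential_nb:
  assumes "potential G m l \<phi> F" "\<phi> v0 = id" "e \<in> I" "e \<in> F"
  shows "\<phi> (nb e) = level l (gn e)"
  using potential_edge[OF assms(1,4) edge[OF assms(3)] gain_in[OF assms(3)]] assms(2) by simp

lemma glue:
  assumes "potential G m l \<phi> F" "potential G m l \<psi> F'" "subpair G W F" "subpair G W' F'"
    and "\<And>w. w \<in> W \<inter> W' \<Longrightarrow> \<phi> w = \<psi> w"
  shows "level_balanced G m l (F \<union> F')"
  unfolding level_balanced_def using potential_glue[OF assms(1-4)] assms(5) by blast

text \<open>If the two far ends coincided, the two edges would form a balanced subgraph on two
  vertices, contradicting 2 + 3 > 4.\<close>

lemma not_parallel:
  assumes "level_balanced G m 3 F" "a \<in> I" "b \<in> I" "a \<noteq> b" "a \<in> F" "b \<in> F"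
  shows "nb a \<noteq> nb b"
proof
  assume eq: "nb a = nb b"
  have "v0 \<in> verts G \<and> nb a \<in> verts G"
    using edge_as_in_subpair[OF edge[OF assms(2)], of "verts G" "arcs G"] assms(2) wf_subpair
    by (simp add: I_def)
  moreover have "tail G e \<in> {v0, nb a} \<and> head G e \<in> {v0, nb a}" if "e \<in> {a, b}" for e
    using edge[OF assms(2)] edge[OF assms(3)] eq that by (auto simp: edge_as_def)
  ultimately have "subpair G {v0, nb a} {a, b}"
    using assms(2,3) unfolding subpair_def I_def by blast
  moreover have "level_balanced G m 3 {a, b}"
    by (rule level_balanced_mono[OF assms(1)]) (use assms in auto)
  ultimately have "card {a, b} + 3 \<le> 2 * card {v0, nb a}"
    using gain_sparseD[OF sparse] by simp
  then show False using assms(4) by (simp add: card_insert_if split: if_splits)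
qed

text \<open>Deleting \<open>v0\<close> together with its only edge lowers the freedom by one.\<close>

lemma pendant:
  assumes sub: "subpair G W F" and e: "F \<inter> I = {e}" and bal: "level_balanced G m l F"
    and l: "1 \<le> l" "l \<le> 3"
  shows "F = {e} \<or> int l + 1 \<le> freedom W F" and "F = {e} \<Longrightarrow> 3 \<le> freedom W F"
    and "2 \<le> l \<Longrightarrow> 3 \<le> freedom W F"
    and "F = {e} \<Longrightarrow> freedom W F \<le> 3 \<Longrightarrow> W = {v0, nb e}"
proof -
  have eF: "e \<in> F" "e \<in> I" using e by auto
  have in_W: "v0 \<in> W" "nb e \<in> W" using in_subpair[OF sub eF(2,1)] by auto
  have fins: "finite W" "finite F" by (rule finite_subpair[OF sub])+
  have sub': "subpair G (W - {v0}) (F - {e})"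
    using sub e unfolding subpair_def I_def by blast
  have bal': "level_balanced G m l (F - {e})"
    by (rule level_balanced_mono[OF bal]) auto
  have fr: "freedom W F = freedom (W - {v0}) (F - {e}) + 1"
    using card.remove[OF fins(1) in_W(1)] card.remove[OF fins(2) eF(1)] by (simp add: freedom_def)
  show "F = {e} \<or> int l + 1 \<le> freedom W F"
    using freedom_ge_level[OF sub' _ bal' l] eF fr by auto
  have W2: "card {v0, nb e} = 2" using nb[OF eF(2)] by simp
  have sub_W: "{v0, nb e} \<subseteq> W" using in_W by simp
  show "3 \<le> freedom W F" if "F = {e}"
    using card_mono[OF fins(1) sub_W] W2 that by (simp add: freedom_def)
  show "W = {v0, nb e}" if "F = {e}" "freedom W F \<le> 3"
    using card_seteq[OF fins(1) sub_W] W2 that by (simp add: freedom_def)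
  show "3 \<le> freedom W F" if "2 \<le> l"
    using freedom_ge_2[OF sub' _ bal' that l(2)] fr in_W nb[OF eF(2)] by auto
qed

text \<open>Two potentials of a subgraph agree on a union of connected components.\<close>

lemma disagreeing_potentials:
  assumes sub: "subpair G W F" and e: "F \<inter> I = {e}" and l: "2 \<le> l" "l \<le> 3"
    and \<phi>: "potential G m l \<phi> F" "\<phi> v0 = id" and \<psi>: "potential G m l \<psi> F" "\<psi> v0 = id"
    and w: "w \<in> W" "\<phi> w \<noteq> \<psi> w"
  shows "5 \<le> freedom W F" and "l = 3 \<Longrightarrow> freedom W F \<le> 5 \<Longrightarrow> F = {e}"
proof -
  define A where "A = {w \<in> W. \<phi> w = \<psi> w}"
  define B where "B = W - A"
  define FA where "FA = {f \<in> F. tail G f \<in> A}"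
  define FB where "FB = F - FA"
  have agree: "\<phi> (head G f) = \<psi> (head G f) \<longleftrightarrow> \<phi> (tail G f) = \<psi> (tail G f)" if "f \<in> F" for f
  proof -
    have "m f \<in> carrier \<Gamma>" using gains sub that by (auto simp: subpair_def)
    then have "level l (m f) \<in> carrier \<Gamma>" by (rule level_closed)
    moreover have "\<phi> (head G f) = \<phi> (tail G f) \<circ> level l (m f)"
      "\<psi> (head G f) = \<psi> (tail G f) \<circ> level l (m f)"
      using \<phi>(1) \<psi>(1) that by (simp_all add: potential_def)
    ultimately show ?thesis using Gamma_cancel_right by metis
  qed
  have ends: "tail G f \<in> W" "head G f \<in> W" if "f \<in> F" for f
    using sub that by (auto simp: subpair_def)
  have subA: "subpair G A FA" and subB: "subpair G B FB"
    using sub ends agree unfolding subpair_def A_def B_def FA_def FB_def by blast+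
  have fins: "finite W" "finite F" by (rule finite_subpair[OF sub])+
  have "A \<subseteq> W" "FA \<subseteq> F" by (auto simp: A_def FA_def)
  then have "card W = card A + card B" "card F = card FA + card FB"
    using fins unfolding B_def FB_def
    by (simp_all add: card_Diff_subset finite_subset card_mono)
  then have fr: "freedom W F = freedom A FA + freedom B FB" by (simp add: freedom_def)
  have eF: "e \<in> F" "e \<in> I" using e by auto
  have "v0 \<in> A" "nb e \<in> A"
    using in_subpair[OF sub eF(2,1)] normalised_potential_nb[OF \<phi> eF(2,1)]
      normalised_potential_nb[OF \<psi> eF(2,1)] \<phi>(2) \<psi>(2) by (auto simp: A_def)
  then have "e \<in> FA" using edge[OF eF(2)] eF(1) by (auto simp: FA_def edge_as_def)
  then have eA: "FA \<inter> I = {e}" using e \<open>FA \<subseteq> F\<close> by blast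
  have bal: "level_balanced G m l F" using \<phi>(1) by (auto simp: level_balanced_def)
  have balA: "level_balanced G m l FA" and balB: "level_balanced G m l FB"
    by (rule level_balanced_mono[OF bal], auto simp: FA_def FB_def)+
  \<comment> \<open>The constant 5 splits as 3 for the agreeing part, where \<open>v0\<close> is
    pendant, and 2 for the nonempty disagreeing part.\<close>
  have A3: "3 \<le> freedom A FA" using pendant(3)[OF subA eA balA _ l(2) l(1)] l by simp
  have "B \<noteq> {}" using w by (auto simp: B_def A_def)
  then have B2: "2 \<le> freedom B FB" using freedom_ge_2[OF subB _ balB l] by simp
  show "5 \<le> freedom W F" using fr A3 B2 by simp
  assume "l = 3" "freedom W F \<le> 5"
  \<comment> \<open>Both bounds are now attained. At level 3, a further edge beside \<open>e\<close>
    would raise the first part to 4, and any edge in the second would raise it to 3.\<close>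
  then have "freedom A FA \<le> 3" "freedom B FB \<le> 2" using fr A3 B2 by auto
  then have "FA = {e}" "FB = {}"
    using pendant(1)[OF subA eA balA] freedom_ge_level[OF subB _ balB] \<open>l = 3\<close> by force+
  then show "F = {e}" using \<open>FA \<subseteq> F\<close> by (auto simp: FB_def)
qed

text \<open>Replacing the edges \<open>a\<close> and \<open>b\<close> at \<open>v0\<close> by the single edge between their other ends
  violates sparsity exactly when some pair \<open>(W, F)\<close> as below contains \<open>a\<close> and \<open>b\<close> but not the
  remaining edge \<open>c\<close>.\<close>

definition blocker :: "'e \<Rightarrow> 'v set \<Rightarrow> 'e set \<Rightarrow> nat \<Rightarrow> bool" where
  "blocker c W F l \<longleftrightarrow> c \<in> I \<and> subpair G W F \<and> F \<inter> I = I - {c} \<and> 1 \<le> l \<and> l \<le> 3 \<and>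
     level_balanced G m l F \<and> freedom W F \<le> int l"

text \<open>In the intersection \<open>v0\<close> is a pendant vertex, so its freedom exceeds \<open>t\<close> unless \<open>a\<close> is its only
  edge.  If it does, the union has freedom below \<open>s\<close>, so the two potentials cannot be glued and the
  intersection is disconnected.\<close>

lemma two_blockers:
  assumes S: "blocker c W F s" and T: "blocker b W' F' t" and st: "s \<le> t"
    and I: "I = {a, b, c}" and distinct: "distinct [a, b, c]"
  shows "t = 3 \<and> F \<inter> F' = {a} \<and> (W \<inter> W' = {v0, nb a} \<or>
    s = 3 \<and> freedom (W \<union> W') (F \<union> F') \<le> 1 \<and> card (W \<inter> W') \<le> 3)"
proof -
  have subS: "subpair G W F" and FS: "F \<inter> I = I - {c}" and s: "1 \<le> s" "s \<le> 3"
    and balS: "level_balanced G m s F" and frS: "freedom W F \<le> int s"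
    using S by (auto simp: blocker_def)
  have subT: "subpair G W' F'" and FT: "F' \<inter> I = I - {b}" and t: "1 \<le> t" "t \<le> 3"
    and balT: "level_balanced G m t F'" and frT: "freedom W' F' \<le> int t"
    using T by (auto simp: blocker_def)
  have subX: "subpair G (W \<inter> W') (F \<inter> F')" and subU: "subpair G (W \<union> W') (F \<union> F')"
    by (rule subpair_Int[OF subS subT] subpair_Un[OF subS subT])+
  have eX: "F \<inter> F' \<inter> I = {a}" using FS FT I distinct by auto
  have balX: "level_balanced G m t (F \<inter> F')" by (rule level_balanced_mono[OF balT]) auto
  note pend = pendant[OF subX eX balX t]
  have U_ne: "F \<union> F' \<noteq> {}" using eX by auto
  have mod: "freedom (W \<union> W') (F \<union> F') \<le> int s + int t - freedom (W \<inter> W') (F \<inter> F')"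
    using freedom_modular[OF subS subT] frS frT by linarith
  have U1: "1 \<le> freedom (W \<union> W') (F \<union> F')" by (rule freedom_ge_1[OF subU U_ne])
  show ?thesis
  proof (cases "int t + 1 \<le> freedom (W \<inter> W') (F \<inter> F')")
    case False
    then have "F \<inter> F' = {a}" using pend(1) by auto
    \<comment> \<open>A subgraph whose only edge is \<open>a\<close> has freedom at least 3, while
      here it is at most t.\<close>
    moreover have "t = 3" using pend(2)[OF calculation] False t by linarith
    moreover have "W \<inter> W' = {v0, nb a}" using pend(4) calculation False by auto
    ultimately show ?thesis by blast
  next
    case True
    then have s2: "2 \<le> s" using mod U1 by linarith
    obtain \<phi> where \<phi>: "potential G m s \<phi> F" "\<phi> v0 = id"
      using level_balanced_normalise[OF balS] by blast
    obtain \<psi> where \<psi>: "potential G m s \<psi> F'" "\<psi> v0 = id"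
      using level_balanced_normalise[OF balanced_antimono[OF balT subT st s(1) t(2)]] by blast
    show ?thesis
    proof (cases "\<forall>w \<in> W \<inter> W'. \<phi> w = \<psi> w")
      case True
      then have "level_balanced G m s (F \<union> F')" by (intro glue[OF \<phi>(1) \<psi>(1) subS subT]) auto
      from freedom_ge_level[OF subU U_ne this s] \<open>int t + 1 \<le> _\<close> mod show ?thesis by linarith
    next
      case False
      then obtain w where w: "w \<in> W \<inter> W'" "\<phi> w \<noteq> \<psi> w" by blast
      note dis = disagreeing_potentials[OF subX eX s2 s(2)
          potential_mono[OF \<phi>(1) Int_lower1] \<phi>(2) potential_mono[OF \<psi>(1) Int_lower2] \<psi>(2) w]
      \<comment> \<open>The disconnected intersection has freedom at least 5 and the union at least
        1, so s + t is at least 6.\<close>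
      have st3: "s = 3" "t = 3" using dis(1) mod U1 s t by linarith+
      have Fa: "F \<inter> F' = {a}" using dis(2) st3 mod U1 by simp
      moreover have "card (W \<inter> W') \<le> 3" "freedom (W \<union> W') (F \<union> F') \<le> 1"
        using dis(1) mod st3 U1 Fa by (simp_all add: freedom_def)
      ultimately show ?thesis using st3 by blast
    qed
  qed
qed

text \<open>Used with the third blocker and the union of the other two. The intersection has at
  least three vertices and at most two edges, so its freedom is at least 4, and the total 3 + 1
  leaves nothing for the union of all three.\<close>

lemma third_pair_freedom:
  assumes O: "subpair G W F" "freedom W F \<le> 3" and PQ: "subpair G W' F'" "freedom W' F' \<le> 1"
    and F: "F \<inter> F' = {x, y}" "x \<in> I" "y \<in> I" and "nb x \<noteq> nb y"
  shows False
proof -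
  have "{v0, nb x, nb y} \<subseteq> W \<inter> W'"
    using in_subpair[OF subpair_Int[OF O(1) PQ(1)] F(2)] in_subpair[OF subpair_Int[OF O(1) PQ(1)] F(3)] F(1)
    by auto
  then have "card {v0, nb x, nb y} \<le> card (W \<inter> W')"
    using finite_subpair(1)[OF O(1)] by (intro card_mono) auto
  then have "3 \<le> card (W \<inter> W')" using nb'[OF F(2)] nb'[OF F(3)] \<open>nb x \<noteq> nb y\<close> by (simp add: card_insert_if)
  moreover have "card {x, y} \<le> 2" by (simp add: card_insert_if)
  ultimately have "4 \<le> freedom (W \<inter> W') (F \<inter> F')" using F(1) by (simp add: freedom_def)
  moreover have "1 \<le> freedom (W \<union> W') (F \<union> F')"
    using F(1) by (intro freedom_ge_1[OF subpair_Un[OF O(1) PQ(1)]]) auto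
  ultimately show False using freedom_modular[OF O(1) PQ(1)] O(2) PQ(2) by linarith
qed

text \<open>Comparing the least level s with the others forces t = r = 3, so only \<open>a\<close>
  and \<open>b\<close>, the edges of the first blocker, can share a far end. In either case all
  three potentials are glued at level s, which requires freedom at least s for the total union,
  while modularity yields at most s - 1.\<close>

lemma three_blockers_min:
  assumes S: "blocker c WS FS s" and T: "blocker b WT FT t" and R: "blocker a WR FR r"
    and min: "s \<le> t" "s \<le> r" and I: "I = {a, b, c}" and distinct: "distinct [a, b, c]"
  shows False
proof -
  have abc: "a \<in> I" "b \<in> I" "c \<in> I" using I by auto
  have subS: "subpair G WS FS" and IS: "FS \<inter> I = I - {c}" and s: "1 \<le> s" "s \<le> 3"
    and balS: "level_balanced G m s FS" and frS: "freedom WS FS \<le> int s"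
    using S by (auto simp: blocker_def)
  have subT: "subpair G WT FT" and IT: "FT \<inter> I = I - {b}"
    and balT: "level_balanced G m t FT" and frT: "freedom WT FT \<le> int t"
    using T by (auto simp: blocker_def)
  have subR: "subpair G WR FR" and IR: "FR \<inter> I = I - {a}"
    and balR: "level_balanced G m r FR" and frR: "freedom WR FR \<le> int r"
    using R by (auto simp: blocker_def)
  have mem: "a \<in> FS" "b \<in> FS" "a \<in> FT" "c \<in> FT" "b \<in> FR" "c \<in> FR"
    using IS IT IR I distinct by auto
  have ST: "t = 3" "FS \<inter> FT = {a}" "WS \<inter> WT = {v0, nb a} \<or>
      s = 3 \<and> freedom (WS \<union> WT) (FS \<union> FT) \<le> 1 \<and> card (WS \<inter> WT) \<le> 3"
    using two_blockers[OF S T min(1) I distinct] by auto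
  have SR: "r = 3" "FS \<inter> FR = {b}" "WS \<inter> WR = {v0, nb b} \<or>
      s = 3 \<and> freedom (WS \<union> WR) (FS \<union> FR) \<le> 1 \<and> card (WS \<inter> WR) \<le> 3"
    using two_blockers[OF S R min(2), of b] I distinct by auto
  have TR: "FT \<inter> FR = {c}" "WT \<inter> WR = {v0, nb c} \<or>
      freedom (WT \<union> WR) (FT \<union> FR) \<le> 1 \<and> card (WT \<inter> WR) \<le> 3"
    using two_blockers[OF T R, of c] I distinct ST(1) SR(1) by auto
  have ac: "nb a \<noteq> nb c" using not_parallel[OF balT[unfolded ST(1)]] abc mem distinct by auto
  have bc: "nb b \<noteq> nb c" using not_parallel[OF balR[unfolded SR(1)]] abc mem distinct by auto
  have subTR: "subpair G (WT \<union> WR) (FT \<union> FR)" by (rule subpair_Un[OF subT subR])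
  have subSTR: "subpair G (WS \<union> (WT \<union> WR)) (FS \<union> (FT \<union> FR))" by (rule subpair_Un[OF subS subTR])
  have FQ: "FS \<inter> (FT \<union> FR) = {a, b}" using ST(2) SR(2) by blast
  have FQ_card: "card (FS \<inter> (FT \<union> FR)) = 2" using FQ distinct by simp
  note modQ = freedom_modular[OF subS subTR]
  have fr_bound: "int s \<le> freedom (WS \<union> (WT \<union> WR)) (FS \<union> (FT \<union> FR))"
    if "level_balanced G m s (FS \<union> (FT \<union> FR))"
    using freedom_ge_level[OF subSTR _ that s] mem by blast
  obtain \<phi> where \<phi>: "potential G m s \<phi> FS" "\<phi> v0 = id"
    using level_balanced_normalise[OF balS] by blast
  obtain \<psi> where \<psi>: "potential G m s \<psi> FT" "\<psi> v0 = id"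
    using level_balanced_normalise[OF balanced_antimono[OF balT subT min(1) s(1)]] ST(1) by blast
  obtain \<rho> where \<rho>: "potential G m s \<rho> FR" "\<rho> v0 = id"
    using level_balanced_normalise[OF balanced_antimono[OF balR subR min(2) s(1)]] SR(1) by blast
  have at_a: "\<phi> (nb a) = level s (gn a)" "\<psi> (nb a) = level s (gn a)"
    using normalised_potential_nb[OF \<phi> abc(1)] normalised_potential_nb[OF \<psi> abc(1)] mem by auto
  have at_b: "\<phi> (nb b) = level s (gn b)" "\<rho> (nb b) = level s (gn b)"
    using normalised_potential_nb[OF \<phi> abc(2)] normalised_potential_nb[OF \<rho> abc(2)] mem by auto
  have at_c: "\<psi> (nb c) = \<rho> (nb c)"
    using normalised_potential_nb[OF \<psi> abc(3)] normalised_potential_nb[OF \<rho> abc(3)] mem by auto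
  have v0T: "v0 \<in> WT" "nb a \<in> WT" "nb c \<in> WT" and v0R: "v0 \<in> WR" "nb b \<in> WR" "nb c \<in> WR"
    using in_subpair[OF subT] in_subpair[OF subR] abc mem by auto
  \<comment> \<open>\<open>T\<close> and \<open>R\<close> are glued first and \<open>S\<close> is
    added afterwards. \<open>S\<close> meets their union only in \<open>v0\<close>,
    \<open>nb a\<close> and \<open>nb b\<close>, where normalisation at \<open>v0\<close> and the
    gains of \<open>a\<close> and \<open>b\<close> determine the values.\<close>
  have key: "level_balanced G m s (FS \<union> (FT \<union> FR))"
    if TR': "\<And>w. w \<in> WT \<inter> WR \<Longrightarrow> \<psi> w = \<rho> w"
      and W: "WS \<inter> WT = {v0, nb a}" "WS \<inter> WR = {v0, nb b}"
  proof -
    let ?\<theta> = "\<lambda>w. if w \<in> WT then \<psi> w else \<rho> w"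
    have \<theta>: "potential G m s ?\<theta> (FT \<union> FR)"
      by (rule potential_glue[OF \<psi>(1) \<rho>(1) subT subR]) (use TR' in auto)
    have "\<phi> w = ?\<theta> w" if "w \<in> WS \<inter> (WT \<union> WR)" for w
    proof -
      have "w \<in> {v0, nb a} \<or> w = nb b" "w = nb b \<Longrightarrow> w \<in> WR" using that W v0R by blast+
      then show ?thesis
        using TR'[of w] at_a at_b \<phi>(2) \<psi>(2) v0T by auto
    qed
    then show ?thesis by (rule glue[OF \<phi>(1) \<theta> subS subTR])
  qed
  show False
  proof (cases "nb a = nb b")
    case False
    \<comment> \<open>With three distinct far ends the exceptional alternative is impossible for
      each pair, so every two blockers meet in a single edge and its two ends.\<close>
    have ST1: "\<not> freedom (WS \<union> WT) (FS \<union> FT) \<le> 1"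
      using third_pair_freedom[OF subR _ subpair_Un[OF subS subT], of b c] frR SR(1,2) TR(1) bc abc
      by auto
    have SR1: "\<not> freedom (WS \<union> WR) (FS \<union> FR) \<le> 1"
      using third_pair_freedom[OF subT _ subpair_Un[OF subS subR], of a c] frT ST(1,2) TR(1) ac abc
      by auto
    have "freedom WS FS \<le> 3" using frS s(2) by linarith
    then have TR1: "\<not> freedom (WT \<union> WR) (FT \<union> FR) \<le> 1"
      using third_pair_freedom[OF subS _ subTR _ FQ abc(1,2) False] by blast
    have W: "WS \<inter> WT = {v0, nb a}" "WS \<inter> WR = {v0, nb b}" "WT \<inter> WR = {v0, nb c}"
      using ST(3) SR(3) TR(2) ST1 SR1 TR1 by blast+
    have "\<psi> w = \<rho> w" if "w \<in> WT \<inter> WR" for w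
      using that \<psi>(2) \<rho>(2) at_c unfolding W(3) by auto
    then have "level_balanced G m s (FS \<union> (FT \<union> FR))" using key[OF _ W(1,2)] by blast
    then have lower: "int s \<le> freedom (WS \<union> (WT \<union> WR)) (FS \<union> (FT \<union> FR))" by (rule fr_bound)
    have "freedom (WT \<inter> WR) (FT \<inter> FR) = 3"
      using W(3) TR(1) nb'[OF abc(3)] by (simp add: freedom_def card_insert_if)
    then have "freedom (WT \<union> WR) (FT \<union> FR) \<le> 3"
      using freedom_modular[OF subT subR] frT frR ST(1) SR(1) by linarith
    moreover have "WS \<inter> (WT \<union> WR) = {v0, nb a, nb b}" using W by blast
    then have "freedom (WS \<inter> (WT \<union> WR)) (FS \<inter> (FT \<union> FR)) = 4"
      using FQ_card False nb'[OF abc(1)] nb'[OF abc(2)] by (simp add: freedom_def card_insert_if)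
    \<comment> \<open>The total union has freedom at most s + 3 - 4.\<close>
    ultimately show False using modQ frS lower by linarith
  next
    case eq: True
    have "s \<noteq> 3" using not_parallel[of FS a b] balS abc mem distinct eq by auto
    then have W: "WS \<inter> WT = {v0, nb a}" "WS \<inter> WR = {v0, nb b}" using ST(3) SR(3) by auto
    have sub3: "{v0, nb c, nb a} \<subseteq> WT \<inter> WR" using v0T v0R eq by auto
    have card3: "card {v0, nb c, nb a} = 3"
      using ac nb'[OF abc(1)] nb'[OF abc(3)] by (simp add: card_insert_if)
    \<comment> \<open>The common far end of \<open>a\<close> and \<open>b\<close> is a third vertex
      of this intersection, which forces the exceptional alternative and thereby freedom at most 1
      for the union of \<open>T\<close> and \<open>R\<close>.\<close>
    have "WT \<inter> WR \<noteq> {v0, nb c}" using sub3 ac nb[OF abc(1)] by auto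
    then have TR1: "freedom (WT \<union> WR) (FT \<union> FR) \<le> 1" "card (WT \<inter> WR) \<le> 3" using TR(2) by auto
    have WTR: "{v0, nb c, nb a} = WT \<inter> WR"
      by (rule card_seteq) (use finite_subpair(1)[OF subT] sub3 card3 TR1(2) in auto)
    have "\<psi> w = \<rho> w" if "w \<in> WT \<inter> WR" for w
      using that at_a at_b at_c \<psi>(2) \<rho>(2) eq unfolding WTR[symmetric] by auto
    then have "level_balanced G m s (FS \<union> (FT \<union> FR))" using key W by blast
    then have lower: "int s \<le> freedom (WS \<union> (WT \<union> WR)) (FS \<union> (FT \<union> FR))" by (rule fr_bound)
    have "WS \<inter> (WT \<union> WR) = {v0, nb a}" using W eq by auto
    then have "freedom (WS \<inter> (WT \<union> WR)) (FS \<inter> (FT \<union> FR)) = 2"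
      using FQ_card nb'[OF abc(1)] by (simp add: freedom_def card_insert_if)
    \<comment> \<open>Here the intersection has two vertices and two edges, so the total union has
      freedom at most s + 1 - 2.\<close>
    then show False using modQ frS TR1(1) lower by linarith
  qed
qed

lemma some_edge_unblocked:
  assumes "card I = 3"
  shows "\<exists>c\<in>I. \<forall>W F l. \<not> blocker c W F l"
proof (rule ccontr)
  assume blocked: "\<not> ?thesis"
  obtain a b c where I: "I = {a, b, c}" and distinct: "distinct [a, b, c]"
    using assms by (auto simp: card_3_iff)
  obtain WS FS s where S: "blocker c WS FS s" using blocked I by blast
  obtain WT FT t where T: "blocker b WT FT t" using blocked I by blast
  obtain WR FR r where R: "blocker a WR FR r" using blocked I by blast
  \<comment> \<open>The argument is symmetric in the three edges; the blocker of least level is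
    given the first role.\<close>
  consider "s \<le> t \<and> s \<le> r" | "t \<le> s \<and> t \<le> r" | "r \<le> s \<and> r \<le> t" by linarith
  then show False
  proof cases
    case 1 then show False using three_blockers_min[OF S T R _ _ I distinct] by blast
  next
    case 2 then show False using three_blockers_min[OF T S R] I distinct by auto
  next
    case 3 then show False using three_blockers_min[OF R S T] I distinct by auto
  qed
qed

end

section \<open>Reducing tight gain graphs\<close>

definition incident_arcs :: "('v, 'e) pre_digraph \<Rightarrow> 'v \<Rightarrow> 'e set" where
  "incident_arcs G v = {e \<in> arcs G. tail G e = v \<or> head G e = v}"

definition other_end :: "('v, 'e) pre_digraph \<Rightarrow> 'v \<Rightarrow> 'e \<Rightarrow> 'v" where
  "other_end G v e = (if tail G e = v then head G e else tail G e)"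

definition gain_from :: "('v, 'e) pre_digraph \<Rightarrow> ('e \<Rightarrow> motion) \<Rightarrow> 'v \<Rightarrow> 'e \<Rightarrow> motion" where
  "gain_from G m v e = (if tail G e = v then m e else inv\<^bsub>\<Gamma>\<^esub> (m e))"

lemma edge_as_incident:
  "e \<in> incident_arcs G v \<Longrightarrow> edge_as G m e v (other_end G v e) (gain_from G m v e)"
  by (auto simp: incident_arcs_def edge_as_def other_end_def gain_from_def)

lemma other_end_in_verts: "wf_digraph G \<Longrightarrow> e \<in> incident_arcs G v \<Longrightarrow> other_end G v e \<in> verts G"
  by (simp add: incident_arcs_def other_end_def wf_digraph.tail_in_verts wf_digraph.head_in_verts)

lemma other_end_eq_iff: "e \<in> incident_arcs G v \<Longrightarrow> other_end G v e = v \<longleftrightarrow> tail G e = v \<and> head G e = v"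
  by (auto simp: incident_arcs_def other_end_def)

lemma gain_from_carrier:
  "\<forall>e\<in>arcs G. m e \<in> carrier \<Gamma> \<Longrightarrow> e \<in> incident_arcs G v \<Longrightarrow> gain_from G m v e \<in> carrier \<Gamma>"
  by (simp add: incident_arcs_def gain_from_def Gamma_inv)

text \<open>Degrees, with loops counted twice, add up to 4|V| - 2, so some degree is at most 3. At
  least two edges meet any vertex because the rest of the graph has at most 2(|V| - 1) - 1
  edges.\<close>

lemma exists_vertex_of_small_degree:
  assumes fin: "fin_digraph G" and sparse: "gain_sparse G m"
    and count: "card (arcs G) + 1 = 2 * card (verts G)" and "2 \<le> card (verts G)"
  shows "\<exists>v\<in>verts G. 2 \<le> card (incident_arcs G v) \<and>
    card (incident_arcs G v) + card {e \<in> arcs G. tail G e = v \<and> head G e = v} \<le> 3"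
proof -
  interpret fin_digraph G by (rule fin)
  define I where "I = incident_arcs G"
  define L where "L v = {e \<in> arcs G. tail G e = v \<and> head G e = v}" for v
  let ?t = "\<lambda>v. card {e \<in> arcs G. tail G e = v}" and ?h = "\<lambda>v. card {e \<in> arcs G. head G e = v}"
  have "(\<Sum>v\<in>verts G. ?t v) = card (arcs G)"
    using sum.group[OF finite_arcs finite_verts, of "tail G" "\<lambda>_. 1 :: nat"] tail_in_verts
    by (simp add: image_subset_iff)
  moreover have "(\<Sum>v\<in>verts G. ?h v) = card (arcs G)"
    using sum.group[OF finite_arcs finite_verts, of "head G" "\<lambda>_. 1 :: nat"] head_in_verts
    by (simp add: image_subset_iff)
  ultimately have sum: "(\<Sum>v\<in>verts G. ?t v + ?h v) = 2 * card (arcs G)" by (simp add: sum.distrib)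
  have "\<exists>v\<in>verts G. ?t v + ?h v \<le> 3"
  proof (rule ccontr)
    assume "\<not> ?thesis"
    then have "card (verts G) * 4 \<le> (\<Sum>v\<in>verts G. ?t v + ?h v)"
      using sum_bounded_below[of "verts G" 4 "\<lambda>v. ?t v + ?h v"] by force
    then show False using sum count by linarith
  qed
  then obtain v where v: "v \<in> verts G" "?t v + ?h v \<le> 3" by blast
  have "?t v + ?h v = card (I v) + card (L v)"
  proof -
    have "I v = {e \<in> arcs G. tail G e = v} \<union> {e \<in> arcs G. head G e = v}"
      "L v = {e \<in> arcs G. tail G e = v} \<inter> {e \<in> arcs G. head G e = v}"
      by (auto simp: I_def incident_arcs_def L_def)
    then show ?thesis
      using card_Un_Int[of "{e \<in> arcs G. tail G e = v}" "{e \<in> arcs G. head G e = v}"] by simp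
  qed
  moreover have "2 \<le> card (I v)"
  proof (cases "arcs G - I v = {}")
    case True
    then have "arcs G = I v" by (auto simp: I_def incident_arcs_def)
    then show ?thesis using count assms(4) by simp
  next
    case False
    have sub: "subpair G (verts G - {v}) (arcs G - I v)"
      using tail_in_verts head_in_verts by (auto simp: subpair_def I_def incident_arcs_def)
    have "card (arcs G - I v) + 1 \<le> 2 * card (verts G - {v})"
      using gain_sparseD[OF sparse sub False _ _ level_balanced_1] by simp
    moreover have "I v \<subseteq> arcs G" by (auto simp: I_def incident_arcs_def)
    then have "card (arcs G - I v) + card (I v) = card (arcs G)"
      by (simp add: card_Diff_subset card_mono finite_subset)
    moreover have "card (verts G - {v}) + 1 = card (verts G)"
      using card.remove[OF finite_verts v(1)] by simp
    ultimately show ?thesis using count by linarith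
  qed
  ultimately show ?thesis using v unfolding I_def L_def by (intro bexI[of _ v]) auto
qed

section \<open>Undoing an extension at a vertex of small degree\<close>

definition delete_vertex :: "('v, 'e) pre_digraph \<Rightarrow> 'v \<Rightarrow> ('v, 'e) pre_digraph" where
  "delete_vertex G v = \<lparr>verts = verts G - {v}, arcs = arcs G - incident_arcs G v,
     tail = tail G, head = head G\<rparr>"

lemma delete_vertex_simps:
  "verts (delete_vertex G v) = verts G - {v}" "arcs (delete_vertex G v) = arcs G - incident_arcs G v"
  "tail (delete_vertex G v) = tail G" "head (delete_vertex G v) = head G"
  by (simp_all add: delete_vertex_def)

lemma delete_vertex_gain_graph:
  assumes G: "gain_graph G m" and sparse: "gain_sparse G m"
  shows "gain_graph (delete_vertex G v) m" "gain_sparse (delete_vertex G v) m"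
proof -
  interpret fin_digraph G by (rule gain_graphD(1)[OF G])
  have fin: "fin_digraph (delete_vertex G v)"
    by unfold_locales (auto simp: delete_vertex_simps incident_arcs_def)
  have bal: "level_balanced (delete_vertex G v) m l F = level_balanced G m l F" for l F
    by (rule level_balanced_cong) (simp_all add: delete_vertex_simps)
  have sub: "subpair G W F" if "subpair (delete_vertex G v) W F" for W F
    using that by (auto simp: subpair_def delete_vertex_simps)
  show sp: "gain_sparse (delete_vertex G v) m"
    unfolding gain_sparse_def bal using gain_sparseD[OF sparse sub] by simp
  show "gain_graph (delete_vertex G v) m"
    using gain_graphD(2)[OF G] by (intro gain_sparse_imp_gain_graph[OF fin _ sp]) (simp add: delete_vertex_simps)
qed

lemma reduce_degree_two:
  assumes G: "gain_graph G m" and sparse: "gain_sparse G m" and v: "v \<in> verts G"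
    and I: "incident_arcs G v = {a, b}" "a \<noteq> b" and b: "other_end G v b \<noteq> v"
  shows "extension_step (delete_vertex G v, m) (G, m)"
proof -
  interpret fin_digraph G by (rule gain_graphD(1)[OF G])
  let ?H = "delete_vertex G v"
  have H: "gain_graph ?H m" by (rule delete_vertex_gain_graph[OF G sparse])
  have arcs: "a \<in> incident_arcs G v" "b \<in> incident_arcs G v" using I by auto
  have "{a, b} \<subseteq> arcs G" using I unfolding incident_arcs_def by blast
  then have VE: "v \<notin> verts ?H" "verts G = insert v (verts ?H)" "{a, b} \<inter> arcs ?H = {}"
    "arcs G = arcs ?H \<union> {a, b}" "distinct [a, b]"
    using v I by (auto simp: delete_vertex_simps)
  have keep: "\<forall>f\<in>arcs ?H. keeps_edge (?H, m) (G, m) f"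
    by (simp add: keeps_edge_def delete_vertex_simps edge_as_self)
  have b_in: "other_end G v b \<in> verts ?H"
    using other_end_in_verts[OF wf_digraph_axioms arcs(2)] b by (simp add: delete_vertex_simps)
  note edges = edge_as_incident[OF arcs(1), of m] edge_as_incident[OF arcs(2), of m]
  show ?thesis
  proof (cases "other_end G v a = v")
    case False
    then have a_in: "other_end G v a \<in> verts ?H"
      using other_end_in_verts[OF wf_digraph_axioms arcs(1)] by (simp add: delete_vertex_simps)
    have "gained_0_extension (?H, m) (G, m)"
      unfolding gained_0_extension_def prod.case
    proof (intro conjI H G exI)
      show "edge_as G m a v (other_end G v a) (gain_from G m v a)"
        "edge_as G m b v (other_end G v b) (gain_from G m v b)" by (rule edges)+
    qed (rule VE keep a_in b_in)+
    then show ?thesis by (simp add: extension_step_def)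
  next
    case True
    \<comment> \<open>A loop that is a translation would be purely periodic on one vertex, but 1 + 2
      > 2.\<close>
    have "cs_component (gain_from G m v a) \<noteq> id"
    proof
      assume "cs_component (gain_from G m v a) = id"
      moreover have ends: "tail G a = v" "head G a = v" using True other_end_eq_iff[OF arcs(1)] by auto
      ultimately have "level 2 (m a) = id" by (simp add: gain_from_def level_def)
      then have "potential G m 2 (\<lambda>_. id) {a}" using Gamma_id by (simp add: potential_def image_subset_iff)
      then have "level_balanced G m 2 {a}" unfolding level_balanced_def by blast
      moreover have "subpair G {v} {a}" using arcs(1) v ends by (simp add: subpair_def incident_arcs_def)
      ultimately show False using gain_sparseD[OF sparse, of "{v}" "{a}" 2] by simp
    qed
    then have "gained_loop_1_extension (?H, m) (G, m)"
      unfolding gained_loop_1_extension_def prod.case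
    proof (intro conjI H G exI)
      show "edge_as G m a v v (gain_from G m v a)" using edges(1) True by simp
      show "edge_as G m b v (other_end G v b) (gain_from G m v b)" by (rule edges)
    qed (rule VE keep b_in | assumption)+
    then show ?thesis by (simp add: extension_step_def)
  qed
qed

text \<open>Two of the edges are replaced by one with the composed gain, leaving out the edge
  \<open>c\<close> that no blocker avoids. A violation in the new graph would lift to a blocker for
  \<open>c\<close>.\<close>

lemma reduce_degree_three:
  assumes G: "gain_graph G m" and sparse: "gain_sparse G m" and v: "v \<in> verts G"
    and I: "card (incident_arcs G v) = 3"
    and no_loop: "\<And>e. e \<in> incident_arcs G v \<Longrightarrow> other_end G v e \<noteq> v"
  shows "\<exists>H n. extension_step (H, n) (G, m) \<and> gain_sparse H n"
proof -
  interpret fin_digraph G by (rule gain_graphD(1)[OF G])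
  define I where "I = incident_arcs G v"
  define nb where "nb = other_end G v"
  define gn where "gn = gain_from G m v"
  have gains: "\<forall>e\<in>arcs G. m e \<in> carrier \<Gamma>" by (rule gain_graphD(2)[OF G])
  have gn: "gn e \<in> carrier \<Gamma>" if "e \<in> I" for e
    using gain_from_carrier[OF gains] that by (simp add: I_def gn_def)
  have edge: "edge_as G m e v (nb e) (gn e)" if "e \<in> I" for e
    using edge_as_incident that by (simp add: I_def nb_def gn_def)
  have nb: "nb e \<noteq> v" "nb e \<in> verts G" if "e \<in> I" for e
    using no_loop other_end_in_verts[OF wf_digraph_axioms] that by (simp_all add: I_def nb_def)
  interpret D: degree_three_vertex G m v I nb gn
    using gains sparse edge nb(1) by unfold_locales (auto simp: I_def incident_arcs_def)
  obtain c where c: "c \<in> I" and unblocked: "\<And>W F l. \<not> D.blocker c W F l"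
    using D.some_edge_unblocked I unfolding I_def by blast
  have "card (I - {c}) = 2" using I c by (simp add: I_def)
  then obtain a b where ab: "I - {c} = {a, b}" "a \<noteq> b" by (auto simp: card_2_iff)
  then have abc: "I = {a, b, c}" "distinct [a, b, c]" "a \<in> I" "b \<in> I" using c by auto
  have I_arcs: "I \<subseteq> arcs G" by (auto simp: I_def incident_arcs_def)
  have not_I: "tail G f \<noteq> v \<and> head G f \<noteq> v" if "f \<in> arcs G" "f \<notin> I" for f
    using that by (auto simp: I_def incident_arcs_def)
  define g where "g = inv\<^bsub>\<Gamma>\<^esub> (gn a) \<circ> gn b"
  define n where "n = m(a := g)"
  \<comment> \<open>The new edge takes over the name \<open>a\<close>, so no fresh edge name has to
    exist in the type.\<close>
  define H where "H = \<lparr>verts = verts G - {v}, arcs = insert a (arcs G - I),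
     tail = (tail G)(a := nb a), head = (head G)(a := nb b)\<rparr>"
  have H_simps: "verts H = verts G - {v}" "arcs H = insert a (arcs G - I)"
    "tail H = (tail G)(a := nb a)" "head H = (head G)(a := nb b)"
    by (simp_all add: H_def)
  have fin: "fin_digraph H"
  proof unfold_locales
    fix e assume "e \<in> arcs H"
    then show "tail H e \<in> verts H" "head H e \<in> verts H"
      using nb abc not_I by (auto simp: H_simps)
  qed (simp_all add: H_simps)
  have gH: "\<forall>e\<in>arcs H. n e \<in> carrier \<Gamma>"
    using gains gn abc by (auto simp: H_simps n_def g_def intro!: Gamma_comp Gamma_inv)
  have sp: "gain_sparse H n"
    unfolding gain_sparse_def
  proof (intro allI impI; elim conjE)
    fix W F l
    assume sub: "subpair H W F" and F: "F \<noteq> {}" and l: "1 \<le> l" "l \<le> (3::nat)"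
      and bal: "level_balanced H n l F"
    obtain \<phi> where \<phi>: "potential H n l \<phi> F" using bal by (auto simp: level_balanced_def)
    have finWF: "finite W" "finite F" using subpair_finite[OF fin sub] by auto
    have F_arcs: "F - {a} \<subseteq> arcs G - I" and W: "W \<subseteq> verts G - {v}"
      using sub by (auto simp: subpair_def H_simps)
    have ends: "tail G f \<in> W" "head G f \<in> W" if "f \<in> F" "f \<noteq> a" for f
      using sub that by (auto simp: subpair_def H_simps)
    have \<phi>_old: "\<phi> (head G f) = \<phi> (tail G f) \<circ> level l (m f)" if "f \<in> F" "f \<noteq> a" for f
      using \<phi> that by (auto simp: potential_def H_simps n_def)
    show "card F + l \<le> 2 * card W"
    proof (cases "a \<in> F")
      case False
      have "potential G m l \<phi> F"
        using \<phi>_old False \<phi> by (auto simp: potential_def)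
      then have "level_balanced G m l F" by (auto simp: level_balanced_def)
      moreover have "subpair G W F" using ends F_arcs W False by (auto simp: subpair_def)
      ultimately show ?thesis using gain_sparseD[OF sparse _ F l] by blast
    next
      case True
      let ?W = "insert v W" and ?F = "insert b F"
      have nb_W: "nb a \<in> W" "nb b \<in> W" using sub True by (auto simp: subpair_def H_simps)
      have bF: "b \<notin> F" using F_arcs abc by auto
      have vW: "v \<notin> W" using W by auto
      \<comment> \<open>The value at \<open>v\<close> is the one that the equation for
        \<open>a\<close> dictates; the equation for \<open>b\<close> then follows from that for the
        new edge, whose gain is \<open>g\<close>.\<close>
      define \<theta> where "\<theta> = \<phi>(v := \<phi> (nb a) \<circ> level l (inv\<^bsub>\<Gamma>\<^esub> (gn a)))"
      have ma: "m a \<in> carrier \<Gamma>" "m b \<in> carrier \<Gamma>" using gains I_arcs abc by auto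
      have \<theta>_a: "\<theta> (nb a) = \<theta> v \<circ> level l (gn a)"
        using nb(1)[OF abc(3)] level_inv_left[OF gn[OF abc(3)], of l] by (simp add: \<theta>_def comp_assoc)
      have "\<phi> (nb b) = \<phi> (nb a) \<circ> level l g"
        using \<phi> True by (auto simp: potential_def H_simps n_def)
      then have \<theta>_b: "\<theta> (nb b) = \<theta> v \<circ> level l (gn b)"
        using nb(1)[OF abc(4)] level_comp[OF Gamma_inv[OF gn[OF abc(3)]] gn[OF abc(4)], of l]
        by (simp add: \<theta>_def g_def comp_assoc)
      have "potential G m l \<theta> ?F"
        unfolding potential_def
      proof (intro conjI ballI)
        have "\<theta> w \<in> carrier \<Gamma>" for w
          using potential_carrier[OF \<phi>] Gamma_comp level_closed[OF Gamma_inv[OF gn[OF abc(3)]]]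
          by (simp add: \<theta>_def)
        then show "range \<theta> \<subseteq> carrier \<Gamma>" by blast
        fix f assume "f \<in> ?F"
        then consider "f = a" | "f = b" | "f \<in> F" "f \<noteq> a" by blast
        then show "\<theta> (head G f) = \<theta> (tail G f) \<circ> level l (m f)"
        proof cases
          case 1 then show ?thesis using potential_edge_iff[OF edge[OF abc(3)] ma(1)] \<theta>_a by blast
        next
          case 2 then show ?thesis using potential_edge_iff[OF edge[OF abc(4)] ma(2)] \<theta>_b by blast
        next
          case 3
          then have "f \<in> arcs G" "f \<notin> I" using F_arcs by auto
          then show ?thesis using \<phi>_old[OF 3] not_I[of f] by (simp add: \<theta>_def)
        qed
      qed
      then have "level_balanced G m l ?F" by (auto simp: level_balanced_def)
      moreover have "subpair G ?W ?F"
      proof -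
        have "tail G f \<in> ?W \<and> head G f \<in> ?W" if "f \<in> ?F" for f
          using that ends[of f] edge_as_subpair_iff[OF edge[OF abc(3)], of ?W]
            edge_as_subpair_iff[OF edge[OF abc(4)], of ?W] nb_W by (cases "f = a"; cases "f = b") simp_all
        moreover have "?F \<subseteq> arcs G" using F_arcs I_arcs abc by blast
        ultimately show ?thesis using W v unfolding subpair_def by blast
      qed
      moreover have "?F \<inter> I = I - {c}" using F_arcs True ab abc by blast
      ultimately have "\<not> freedom ?W ?F \<le> int l"
        using unblocked[of ?W ?F l] c l by (simp add: D.blocker_def)
      \<comment> \<open>The lifted pair has one more vertex and one more edge, so its freedom is
        larger by exactly 1; being above l, it leaves at least l for the original pair.\<close>
      then show ?thesis using bF vW finWF by (simp add: freedom_def)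
    qed
  qed
  have gain_H: "gain_graph H n" by (rule gain_sparse_imp_gain_graph[OF fin gH sp])
  have "gained_1_extension (H, n) (G, m)"
    unfolding gained_1_extension_def prod.case
  proof (intro conjI gain_H G exI)
    show "v \<notin> verts H" "verts G = insert v (verts H)" using v by (auto simp: H_simps)
    show "nb c \<in> verts H" using nb[OF c] by (simp add: H_simps)
    show "edge_as H n a (nb a) (nb b) g" by (simp add: edge_as_def H_simps n_def)
    show "distinct [a, b, c]" by (rule abc(2))
    show "{a, b, c} \<inter> (arcs H - {a}) = {}" using abc by (auto simp: H_simps)
    show "arcs G = arcs H - {a} \<union> {a, b, c}" using abc I_arcs by (auto simp: H_simps)
    show "\<forall>f\<in>arcs H - {a}. keeps_edge (H, n) (G, m) f"
      by (auto simp: keeps_edge_def H_simps n_def intro: edge_as_self)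
    show "edge_as G m a v (nb a) (gn a)" "edge_as G m b v (nb b) (gn b)" "edge_as G m c v (nb c) (gn c)"
      using edge abc c by auto
    show "inv\<^bsub>\<Gamma>\<^esub> (gn a) \<otimes>\<^bsub>\<Gamma>\<^esub> gn b = g" by (simp only: g_def Gamma_mult)
  qed
  then show ?thesis using sp by (auto simp: extension_step_def)
qed

section \<open>Induction on the number of vertices\<close>

lemma tight_reduction:
  assumes G: "gain_graph G m" and tight: "\<Gamma>_tight G m" and "card (verts G) \<noteq> 1"
  shows "\<exists>H n. extension_step (H, n) (G, m) \<and> \<Gamma>_tight H n \<and> card (verts H) < card (verts G)"
proof -
  interpret fin_digraph G by (rule gain_graphD(1)[OF G])
  have count: "card (arcs G) + 1 = 2 * card (verts G)" and sparse: "gain_sparse G m"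
    using tight tight_iff_gain_sparse[OF gain_graphD(1,2)[OF G]] by auto
  have "2 \<le> card (verts G)" using count assms(3) by linarith
  then obtain v where v: "v \<in> verts G" and I2: "2 \<le> card (incident_arcs G v)" and
    I3: "card (incident_arcs G v) + card {e \<in> arcs G. tail G e = v \<and> head G e = v} \<le> 3"
    using exists_vertex_of_small_degree[OF gain_graphD(1)[OF G] sparse count] by blast
  let ?L = "{e \<in> arcs G. tail G e = v \<and> head G e = v}"
  have finL: "finite ?L" by simp
  have loop: "e \<in> ?L" if "e \<in> incident_arcs G v" "other_end G v e = v" for e
    using that other_end_eq_iff[OF that(1)] by (simp add: incident_arcs_def)
  have "\<exists>H n. extension_step (H, n) (G, m) \<and> gain_sparse H n"
  proof (cases "card (incident_arcs G v) = 2")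
    case False
    then have "card (incident_arcs G v) = 3" "card ?L = 0" using I2 I3 by linarith+
    moreover from this(2) have "?L = {}" using finL by simp
    ultimately show ?thesis using loop by (intro reduce_degree_three[OF G sparse v]) blast+
  next
    case True
    then obtain a b where ab: "incident_arcs G v = {a, b}" "a \<noteq> b" by (auto simp: card_2_iff)
    \<comment> \<open>Two loops at \<open>v\<close> would count twice each, giving degree 4 against
      the bound 3.\<close>
    have "\<not> (a \<in> ?L \<and> b \<in> ?L)"
    proof
      assume "a \<in> ?L \<and> b \<in> ?L"
      then have "{a, b} \<subseteq> ?L" by blast
      from card_mono[OF finL this] show False using ab(2) True I3 by simp
    qed
    then have "other_end G v a \<noteq> v \<or> other_end G v b \<noteq> v" using loop ab(1) by blast
    then have "extension_step (delete_vertex G v, m) (G, m)"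
      using reduce_degree_two[OF G sparse v ab] reduce_degree_two[OF G sparse v, of b a] ab
      by (auto simp: insert_commute)
    then show ?thesis using delete_vertex_gain_graph(2)[OF G sparse] by blast
  qed
  then obtain H n where H: "extension_step (H, n) (G, m)" "gain_sparse H n" by blast
  have gH: "gain_graph H n" using extension_step_gain_graph[OF H(1)] by simp
  \<comment> \<open>Every extension adds one vertex and two edges, so the edge count of a tight
    graph carries back to \<open>H\<close>.\<close>
  have "\<Gamma>_tight H n"
    using tight_iff_gain_sparse[OF gain_graphD(1,2)[OF gH]] H(2) extension_step_gain_sparse[OF H] count by simp
  then show ?thesis using H(1) extension_step_gain_sparse[OF H] by auto
qed

lemma tight_obtained_from_K11:
  assumes "gain_graph G m" "\<Gamma>_tight G m"
  shows "\<exists>K k. gain_graph K k \<and> is_K11 K \<and> \<Gamma>_tight K k \<and> extension_step\<^sup>*\<^sup>* (K, k) (G, m)"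
  using assms
proof (induction "card (verts G)" arbitrary: G m rule: less_induct)
  case less
  show ?case
  proof (cases "card (verts G) = 1")
    case True
    have "card (arcs G) + 1 = 2 * card (verts G)"
      using less.prems tight_iff_gain_sparse[OF gain_graphD(1,2)[OF less.prems(1)]] by simp
    then have "is_K11 G" using True gain_graph_wf[OF less.prems(1)] by (simp add: is_K11_def)
    then show ?thesis using less.prems by blast
  next
    case False
    obtain H n where H: "extension_step (H, n) (G, m)" "\<Gamma>_tight H n" "card (verts H) < card (verts G)"
      using tight_reduction[OF less.prems False] by blast
    have "gain_graph H n" using extension_step_gain_graph[OF H(1)] by simp
    then obtain K k where K: "gain_graph K k" "is_K11 K" "\<Gamma>_tight K k" "extension_step\<^sup>*\<^sup>* (K, k) (H, n)"
      using less.hyps[OF H(3) _ H(2)] by blast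
    have "extension_step\<^sup>*\<^sup>* (K, k) (G, m)" using K(4) H(1) by (rule rtranclp.rtrancl_into_rtrancl)
    then show ?thesis using K(1-3) by blast
  qed
qed

theorem theorem5p1:
  fixes G :: "('v, 'e) pre_digraph" and m :: "'e \<Rightarrow> motion"
  assumes "gain_graph G m"
  shows "\<Gamma>_tight G m \<longleftrightarrow>
    (\<exists>K k. gain_graph K k \<and> is_K11 K \<and> \<Gamma>_tight K k \<and> extension_step\<^sup>*\<^sup>* (K, k) (G, m))"
proof
  assume "\<Gamma>_tight G m"
  with assms show "\<exists>K k. gain_graph K k \<and> is_K11 K \<and> \<Gamma>_tight K k \<and> extension_step\<^sup>*\<^sup>* (K, k) (G, m)"
    by (rule tight_obtained_from_K11)
next
  assume "\<exists>K k. gain_graph K k \<and> is_K11 K \<and> \<Gamma>_tight K k \<and> extension_step\<^sup>*\<^sup>* (K, k) (G, m)"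
  then obtain K k where K: "\<Gamma>_tight K k" "extension_step\<^sup>*\<^sup>* (K, k) (G, m)" by blast
  have "case X of (H, n) \<Rightarrow> \<Gamma>_tight H n" if "extension_step\<^sup>*\<^sup>* (K, k) X" for X
    using that
  proof induction
    case base show ?case using K(1) by simp
  next
    case (step X Y)
    then show ?case using extension_step_tight by (cases X; cases Y) auto
  qed
  from this[OF K(2)] show "\<Gamma>_tight G m" by simp
qed

end
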